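(* Let $f:\mathbb{GA}_N\to\mathbb{G\overline A}{}_N$ be an equitorsion almost geodesic mapping of the type $\underset{1}{\pi}{}_3$, with basic equations $$\overline L{}^i_{\underline{jk}}=L^i_{\underline{jk}}+\psi_j\delta^i_k+\psi_k\delta^i_j+2\sigma_{jk}\varphi^i,\qquad \varphi^i_{\underset{1}{|}j}=\underset{1}{\nu}{}_j\varphi^i+\underset{1}{\mu}\,\delta^i_j ,$$ where $\psi_j$ and $\underset{1}{\nu}{}_j$ are $1$-forms, $\sigma_{jk}=\sigma_{kj}$ is a symmetric tensor, $\varphi^i$ is a contravariant vector and $\underset{1}{\mu}$ is a scalar. Then the following hold. (1) The geometrical object $$\underset{1}{\widetilde{\mathcal T}}{}^i_{jk}=L^i_{\underline{jk}}-\frac1{N+1}\delta^i_k\big(L^\alpha_{\underline{j\alpha}}+\sigma_{j\alpha}\varphi^\alpha\big)-\frac1{N+1}\delta^i_j\big(L^\alpha_{\underline{k\alpha}}+\sigma_{k\alpha}\varphi^\alpha\big)+\sigma_{jk}\varphi^i$$ is an invariant (the basic invariant of the Thomas type) for the mapping $f$. The invariance of this geometrical object is total. (2) The geometrical object $$\begin{aligned} \underset{1}{\widetilde{\mathcal W}}{}^i_{jmn}&=R^i_{jmn}+\frac1{N+1}\delta^i_j\Big(R_{[mn]}-\big(\sigma_{[m\alpha|n]}-\sigma_{[m\beta}L^\beta_{\underset{\vee}{\alpha n}]}+\sigma_{[m\alpha}\underset{1}{\nu}{}_{n]}\big)\varphi^\alpha\Big)\\ &+\sigma_{j[m|n]}\varphi^i+\sigma_{j[m}\sigma_{\alpha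 n]}\varphi^\alpha\varphi^i-\sigma_{j[m}L^i_{\underset{\vee}{\alpha n}]}\varphi^\alpha+\sigma_{j[m}\underset{1}{\nu}{}_{n]}\varphi^i-\delta^i_{[m}\underset{1}{\mu}\,\sigma_{jn]}\\ &-\frac1{N+1}\Big(\delta^i_{[m}L^\alpha_{\underline{j\alpha}|n]}+\big(\delta^i_{[m}\sigma_{j\alpha|n]}-\delta^i_{[m}\sigma_{j\beta}L^\beta_{\underset{\vee}{\alpha n}]}+\delta^i_{[m}\sigma_{j\alpha}\underset{1}{\nu}{}_{n]}\big)\varphi^\alpha+\delta^i_{[m}\underset{1}{\mu}\,\sigma_{jn]}\Big)\\ &+\frac1{N+1}\delta^i_{[m}\sigma_{jn]}\big(L^\beta_{\underline{\alpha\beta}}+\sigma_{\alpha\beta}\varphi^\beta\big)\varphi^\alpha\\ &-\frac1{(N+1)^2}\big(L^\alpha_{\underline{j\alpha}}+\sigma_{j\alpha}\varphi^\alpha\big)\big(\delta^i_{[m}L^\beta_{\underline{n]\beta}}+\delta^i_{[m}\sigma_{n]\beta}\varphi^\beta\big) \end{aligned}$$ is an invariant (the basic associated invariant) for the mapping $f$. The invariance of this geometrical object is valued. It is total if and only if the mapping $f$ has the property of reciprocity. (3) The geometrical object $$\begin{aligned} \underset{1}{\widetilde W}{}^i_{jmn}&=R^i_{jmn}+\frac1{N+1}\delta^i_jR_{[mn]}+\frac N{N^2-1}\delta^i_{[m}R_{jn]}+\frac1{N^2-1}\delta^i_{[m}R_{n]j}\\ &+\sigma_{j[m|n]}\varphi^i-\sigma_{j[m}L^i_{\underset{\vee}{\alpha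 n}]}\varphi^\alpha+\sigma_{j[m}\underset{1}{\nu}{}_{n]}\varphi^i+\sigma_{j[m}\sigma_{\alpha n]}\varphi^\alpha\varphi^i\\ &+\frac1{N-1}\big(\delta^i_{[m}\sigma_{jn]|\alpha}-\delta^i_{[m}\sigma_{jn]}L^\beta_{\underset{\vee}{\alpha\beta}}+\delta^i_{[m}\sigma_{jn]}\underset{1}{\nu}{}_\alpha\big)\varphi^\alpha\\ &+\frac1{N-1}\big(\delta^i_{[m}\sigma_{jn]}\sigma_{\alpha\beta}-\delta^i_{[m}\sigma_{j\alpha}\sigma_{n]\beta}\big)\varphi^\alpha\varphi^\beta\\ &-\frac N{N^2-1}\big(\delta^i_{[m}\sigma_{\alpha j|n]}-\delta^i_{[m}\sigma_{\beta j}L^\beta_{\underset{\vee}{\alpha n}]}+\delta^i_{[m}\sigma_{\alpha j}\underset{1}{\nu}{}_{n]}\big)\varphi^\alpha\\ &-\frac1{N^2-1}\big(\delta^i_{[m}\sigma_{\alpha n]|j}-\delta^i_{[m}\sigma_{\beta n]}L^\beta_{\underset{\vee}{\alpha j}}+\delta^i_{[m}\sigma_{\alpha n]}\underset{1}{\nu}{}_j\big)\varphi^\alpha \end{aligned}$$ is an invariant (the associated derived invariant of the Weyl type) for the mapping $f$. The invariance of this geometrical object is valued. It is total if and only if the mapping $f$ has the property of reciprocity. (4) For all coefficients $u,u'$ and all $p^1=(p^1_1,p^1_2,p^1_3)$, $p^2=(p^2_1,p^2_2,p^2_3)$ with $p^a_b\in\{1,2\}$, the geometrical objects $$\begin{aligned}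 \underset{1}{\mathcal W}{}^i_{0.(p^1).(p^2).jmn}&=\underset{1}{\widetilde{\mathcal W}}{}^i_{jmn}+uL^i_{\underset{\vee}{jm}|n}+u'L^i_{\underset{\vee}{jn}|m}\\ &-u\big(\omega^i_{(p^1_1).\alpha n}L^\alpha_{\underset{\vee}{jm}}-\omega^\alpha_{(p^1_2).jn}L^i_{\underset{\vee}{\alpha m}}-\omega^\alpha_{(p^1_3).mn}L^i_{\underset{\vee}{j\alpha}}\big)\\ &-u'\big(\omega^i_{(p^2_1).\alpha m}L^\alpha_{\underset{\vee}{jn}}-\omega^\alpha_{(p^2_2).jm}L^i_{\underset{\vee}{\alpha n}}-\omega^\alpha_{(p^2_3).mn}L^i_{\underset{\vee}{j\alpha}}\big) \end{aligned}$$ and $$\begin{aligned} \underset{1}{W}{}^i_{0.(p^1).(p^2).jmn}&=\underset{1}{\widetilde W}{}^i_{jmn}+uL^i_{\underset{\vee}{jm}|n}+u'L^i_{\underset{\vee}{jn}|m}\\ &-u\big(\omega^i_{(p^1_1).\alpha n}L^\alpha_{\underset{\vee}{jm}}-\omega^\alpha_{(p^1_2).jn}L^i_{\underset{\vee}{\alpha m}}-\omega^\alpha_{(p^1_3).mn}L^i_{\underset{\vee}{j\alpha}}\big)\\ &-u'\big(\omega^i_{(p^2_1).\alpha m}L^\alpha_{\underset{\vee}{jn}}-\omega^\alpha_{(p^2_2).jm}L^i_{\underset{\vee}{\alpha n}}-\omega^\alpha_{(p^2_3).mn}L^i_{\underset{\vee}{j\alpha}}\big) \end{aligned}$$ are invariants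 for the mapping $f$, where $\omega^i_{(1).jk}=L^i_{\underline{jk}}$, $\omega^i_{(2).jk}=\omega^i_{jk}$ and $$\omega^i_{jk}=\frac1{N+1}\delta^i_k\big(L^\alpha_{\underline{j\alpha}}+\sigma_{j\alpha}\varphi^\alpha\big)+\frac1{N+1}\delta^i_j\big(L^\alpha_{\underline{k\alpha}}+\sigma_{k\alpha}\varphi^\alpha\big)-\sigma_{jk}\varphi^i .$$ The invariance of these geometrical objects is valued. It is total if and only if the mapping $f$ has the property of reciprocity.
   Context: Spaces. A non-symmetric affine connection space $\mathbb{GA}_N$ is an $N$-dimensional manifold ($N>1$) with an affine connection $\nabla$ whose coefficients $L^i_{jk}$ are not symmetric in $j,k$. Put $L^i_{\underline{jk}}=\frac12(L^i_{jk}+L^i_{kj})$ and $L^i_{\underset{\vee}{jk}}=\frac12(L^i_{jk}-L^i_{kj})$. The associated space $\mathbb A_N$ is the manifold with the symmetric connection of coefficients $L^i_{\underline{jk}}$. A mapping $f:\mathbb{GA}_N\to\mathbb{G\overline A}{}_N$ is described in a common coordinate system; the objects of $\mathbb{G\overline A}{}_N$ are denoted by a bar (connection coefficients $\overline L{}^i_{jk}$). Repeated indices are summed; a comma denotes partial derivative. Covariant derivatives. The covariant derivative in $\mathbb A_N$ is $a^i_{j|k}=a^i_{j,k}+L^i_{\underline{\alpha k}}a^\alpha_j-L^\alpha_{\underline{jk}}a^i_\alpha$ (similarly for other valences; $\|$ denotes the one in $\overline{\mathbb A}_N$). The covariant derivative of the first kind in $\mathbb{GA}_N$ is $a^i_{j\underset{1}{|}k}=a^i_{j,k}+L^i_{\alpha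 k}a^\alpha_j-L^\alpha_{jk}a^i_\alpha$; in particular $\varphi^i_{\underset{1}{|}j}=\varphi^i_{,j}+L^i_{\alpha j}\varphi^\alpha$. One uses the notation $L^i_{\underline{jm}|n}=L^i_{\underline{jm},n}+L^i_{\underline{\alpha n}}L^\alpha_{\underline{jm}}-L^\alpha_{\underline{jn}}L^i_{\underline{\alpha m}}-L^\alpha_{\underline{mn}}L^i_{\underline{j\alpha}}$, and $L^\alpha_{\underline{j\alpha}|n}$ is its contraction in $i$ and $m$. Curvature. $R^i_{jmn}=L^i_{\underline{jm},n}-L^i_{\underline{jn},m}+L^\alpha_{\underline{jm}}L^i_{\underline{\alpha n}}-L^\alpha_{\underline{jn}}L^i_{\underline{\alpha m}}$ is the curvature tensor of $\mathbb A_N$ and $R_{ij}=R^\alpha_{ij\alpha}$ its Ricci tensor. The coefficients $u,u'$ are those of the family of curvature tensors of $\mathbb{GA}_N$, $K^i_{jmn}=R^i_{jmn}+uL^i_{\underset{\vee}{jm}|n}+u'L^i_{\underset{\vee}{jn}|m}+vL^\alpha_{\underset{\vee}{jm}}L^i_{\underset{\vee}{\alpha n}}+v'L^\alpha_{\underset{\vee}{jn}}L^i_{\underset{\vee}{\alpha m}}+wL^\alpha_{\underset{\vee}{mn}}L^i_{\underset{\vee}{\alpha j}}$. Brackets. Square brackets denote antisymmetrization without division, in the two extreme indices inside the bracket only, all other indices remaining fixed: e.g. $R_{[mn]}=R_{mn}-R_{nm}$, $\delta^i_{[m}\sigma_{jn]}=\delta^i_m\sigma_{jn}-\delta^i_n\sigma_{jm}$,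 $\delta^i_{[m}R_{n]j}=\delta^i_mR_{nj}-\delta^i_nR_{mj}$, $\sigma_{j[m|n]}=\sigma_{jm|n}-\sigma_{jn|m}$, $\sigma_{[m\alpha|n]}=\sigma_{m\alpha|n}-\sigma_{n\alpha|m}$, $\sigma_{j[m}L^i_{\underset{\vee}{\alpha n}]}=\sigma_{jm}L^i_{\underset{\vee}{\alpha n}}-\sigma_{jn}L^i_{\underset{\vee}{\alpha m}}$. The vertical bar inside brackets is the covariant derivative in $\mathbb A_N$. Mappings. An almost geodesic mapping is one that takes every geodesic line of $\mathbb{GA}_N$ to an almost geodesic line of $\mathbb{G\overline A}{}_N$; those of type $\underset{1}{\pi}{}_3$ are given by the two basic equations displayed in the claim. The mapping is equitorsion if $\overline L{}^i_{\underset{\vee}{jk}}=L^i_{\underset{\vee}{jk}}$. An almost geodesic mapping of type $\underset{1}{\pi}{}_3$ has the property of reciprocity if its inverse mapping $f^{-1}:\mathbb{G\overline A}{}_N\to\mathbb{GA}_N$ is also an almost geodesic mapping of type $\underset{1}{\pi}{}_3$. For the inverse mapping, the tensor $D^i_{jk}=2\sigma_{jk}\varphi^i$ is replaced by $\overline D{}^i_{jk}=-D^i_{jk}$, so that $L^i_{\underline{jk}}=\overline L{}^i_{\underline{jk}}-\psi_j\delta^i_k-\psi_k\delta^i_j+\overline D{}^i_{jk}$. Invariance. Let $U^{i_1\ldots i_p}_{j_1\ldots j_q}$ be a geometrical object of type $(p,q)$ and $f:\mathbb{GA}_N\to\mathbb{G\overline A}{}_N$ a transformation. If $f$ preserves the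 value of $U^{i_1\ldots i_p}_{j_1\ldots j_q}$ but changes its form to $\overline V{}^{i_1\ldots i_p}_{j_1\ldots j_q}$, the invariance of $U$ under $f$ is called valued. If $f$ preserves both the value and the form of $U^{i_1\ldots i_p}_{j_1\ldots j_q}$ (i.e. $\overline U=U$, with $\overline U$ given by the same formula in the corresponding objects of $\mathbb{G\overline A}{}_N$), the invariance of $U$ under $f$ is called total.
   Formalization: In (3) and the second family of (4) the summand -(1/(N+1))δ^i_j(σ_[mα|n]-σ_[mβ}L^β_αn]+σ_[mα}ν_n])φ^α is added; the formula as printed is shown valued, and total iff reciprocity holds and this bracket, contracted with φ^α, vanishes, since the printed claim is false. *)

theory Defs
  imports "HOL-Analysis.Analysis"
begin

text \<open>
  Everything is expressed in the common coordinate system of the two spaces: \<open>M\<close> is the open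
  coordinate domain in \<open>\<real>^'n\<close>, \<open>N = CARD('n)\<close>, and geometric objects are families of component
  functions.  \<open>L i j k\<close> is the coefficient with upper index \<open>i\<close> and lower indices \<open>j k\<close>; in
  all objects the upper index comes first.
\<close>

type_synonym 'n scalar_field = "real ^ 'n \<Rightarrow> real"
type_synonym 'n covector_field = "'n \<Rightarrow> real ^ 'n \<Rightarrow> real"
type_synonym 'n vector_field = "'n \<Rightarrow> real ^ 'n \<Rightarrow> real"
type_synonym 'n tensor02_field = "'n \<Rightarrow> 'n \<Rightarrow> real ^ 'n \<Rightarrow> real"
type_synonym 'n connection = "'n \<Rightarrow> 'n \<Rightarrow> 'n \<Rightarrow> real ^ 'n \<Rightarrow> real"

definition partial :: "'n::finite \<Rightarrow> 'n scalar_field \<Rightarrow> 'n scalar_field" where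
  "partial k f x = frechet_derivative f (at x) (axis k 1)"

primrec Ck :: "nat \<Rightarrow> (real ^ 'n::finite) set \<Rightarrow> 'n scalar_field \<Rightarrow> bool" where
  "Ck 0 M f \<longleftrightarrow> continuous_on M f"
| "Ck (Suc r) M f \<longleftrightarrow> (\<forall>x\<in>M. f differentiable (at x)) \<and> (\<forall>k. Ck r M (partial k f))"

definition smooth :: "(real ^ 'n::finite) set \<Rightarrow> 'n scalar_field \<Rightarrow> bool" where
  "smooth M f \<longleftrightarrow> (\<forall>r. Ck r M f)"

definition delta :: "'n \<Rightarrow> 'n \<Rightarrow> real" where
  "delta i j = (if i = j then 1 else 0)"

text \<open>Antisymmetrization without division in the two indices that are passed last.\<close>

definition brack :: "('n \<Rightarrow> 'n \<Rightarrow> real) \<Rightarrow> 'n \<Rightarrow> 'n \<Rightarrow> real" where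
  "brack F m n = F m n - F n m"


section \<open>Connections\<close>

definition symm :: "'n connection \<Rightarrow> 'n connection" where
  "symm L i j k x = (L i j k x + L i k j x) / 2"

definition tors :: "'n connection \<Rightarrow> 'n connection" where
  "tors L i j k x = (L i j k x - L i k j x) / 2"

definition nonsymmetric_space :: "(real ^ 'n::finite) set \<Rightarrow> 'n connection \<Rightarrow> bool" where
  "nonsymmetric_space M L \<longleftrightarrow>
     (\<forall>i j k. smooth M (L i j k)) \<and> (\<exists>x\<in>M. \<exists>i j k. L i j k x \<noteq> L i k j x)"

text \<open>
  Covariant derivatives in the associated space, the last index being the direction of
  differentiation.  \<open>cov12\<close> is also applied to the coefficients \<open>symm L\<close> themselves, although these
  are not components of a tensor.
\<close>

definition cov02 :: "'n::finite connection \<Rightarrow> 'n tensor02_field \<Rightarrow> 'n \<Rightarrow> 'n \<Rightarrow> 'n \<Rightarrow> 'n scalar_field" where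
  "cov02 L a j m n x = partial n (a j m) x
     - (\<Sum>\<alpha>\<in>UNIV. symm L \<alpha> j n x * a \<alpha> m x) - (\<Sum>\<alpha>\<in>UNIV. symm L \<alpha> m n x * a j \<alpha> x)"

definition cov12 :: "'n::finite connection \<Rightarrow> 'n connection \<Rightarrow> 'n \<Rightarrow> 'n \<Rightarrow> 'n \<Rightarrow> 'n \<Rightarrow> 'n scalar_field" where
  "cov12 L a i j m n x = partial n (a i j m) x
     + (\<Sum>\<alpha>\<in>UNIV. symm L i \<alpha> n x * a \<alpha> j m x)
     - (\<Sum>\<alpha>\<in>UNIV. symm L \<alpha> j n x * a i \<alpha> m x) - (\<Sum>\<alpha>\<in>UNIV. symm L \<alpha> m n x * a i j \<alpha> x)"

definition cov_first_kind :: "'n::finite connection \<Rightarrow> 'n vector_field \<Rightarrow> 'n \<Rightarrow> 'n \<Rightarrow> 'n scalar_field" where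
  "cov_first_kind L v i j x = partial j (v i) x + (\<Sum>\<alpha>\<in>UNIV. L i \<alpha> j x * v \<alpha> x)"

definition curvature :: "'n::finite connection \<Rightarrow> 'n \<Rightarrow> 'n \<Rightarrow> 'n \<Rightarrow> 'n \<Rightarrow> 'n scalar_field" where
  "curvature L i j m n x = partial n (symm L i j m) x - partial m (symm L i j n) x
     + (\<Sum>\<alpha>\<in>UNIV. symm L \<alpha> j m x * symm L i \<alpha> n x) - (\<Sum>\<alpha>\<in>UNIV. symm L \<alpha> j n x * symm L i \<alpha> m x)"

definition ricci :: "'n::finite connection \<Rightarrow> 'n \<Rightarrow> 'n \<Rightarrow> 'n scalar_field" where
  "ricci L i j x = (\<Sum>\<alpha>\<in>UNIV. curvature L \<alpha> i j \<alpha> x)"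


section \<open>Almost geodesic mappings of the third type, first kind\<close>

text \<open>
  The objects of a space that enter the invariants: the connection coefficients and the data
  \<open>\<sigma>, \<phi>, \<nu>, \<mu>\<close> of the basic equations of a mapping that starts in this space.
\<close>

record ('n::finite) space_data =
  coeff :: "'n connection"
  sig   :: "'n tensor02_field"
  phi   :: "'n vector_field"
  nu    :: "'n covector_field"
  mu    :: "'n scalar_field"

definition admissible_data :: "(real ^ 'n::finite) set \<Rightarrow> 'n space_data \<Rightarrow> bool" where
  "admissible_data M a \<longleftrightarrow> nonsymmetric_space M (coeff a)
     \<and> (\<forall>j k. smooth M (sig a j k)) \<and> (\<forall>j k. \<forall>x\<in>M. sig a j k x = sig a k j x)
     \<and> (\<forall>i. smooth M (phi a i)) \<and> (\<forall>j. smooth M (nu a j)) \<and> smooth M (mu a)"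

text \<open>The mapping goes from the space with coefficients \<open>coeff a\<close> to the one with coefficients \<open>Lbar\<close>.\<close>

definition pi3_mapping ::
  "(real ^ 'n::finite) set \<Rightarrow> 'n covector_field \<Rightarrow> 'n space_data \<Rightarrow> 'n connection \<Rightarrow> bool" where
  "pi3_mapping M \<psi> a Lbar \<longleftrightarrow>
     admissible_data M a \<and> nonsymmetric_space M Lbar \<and> (\<forall>j. smooth M (\<psi> j))
     \<and> (\<forall>x\<in>M. \<forall>i j k. symm Lbar i j k x =
          symm (coeff a) i j k x + \<psi> j x * delta i k + \<psi> k x * delta i j + 2 * sig a j k x * phi a i x)
     \<and> (\<forall>x\<in>M. \<forall>i j. cov_first_kind (coeff a) (phi a) i j x = nu a j x * phi a i x + mu a x * delta i j)"

definition equitorsion :: "(real ^ 'n) set \<Rightarrow> 'n connection \<Rightarrow> 'n connection \<Rightarrow> bool" where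
  "equitorsion M L Lbar \<longleftrightarrow> (\<forall>x\<in>M. \<forall>i j k. tors Lbar i j k x = tors L i j k x)"

definition equitorsion_pi3_mapping ::
  "(real ^ 'n::finite) set \<Rightarrow> 'n covector_field \<Rightarrow> 'n space_data \<Rightarrow> 'n connection \<Rightarrow> bool" where
  "equitorsion_pi3_mapping M \<psi> a Lbar \<longleftrightarrow> pi3_mapping M \<psi> a Lbar \<and> equitorsion M (coeff a) Lbar"

definition reciprocity :: "(real ^ 'n::finite) set \<Rightarrow> 'n space_data \<Rightarrow> 'n connection \<Rightarrow> bool" where
  "reciprocity M a Lbar \<longleftrightarrow> (\<exists>\<psi>' b. coeff b = Lbar \<and> pi3_mapping M \<psi>' b (coeff a))"

text \<open>
  \<open>b\<close> consists of objects of the target space that correspond to those of \<open>a\<close>: the tensor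
  \<open>2 \<sigma>\<^sub>j\<^sub>k \<phi>\<^sup>i\<close> changes sign.  This fixes the product of \<open>\<sigma>\<close> and \<open>\<phi>\<close> only, not the factors.
\<close>

definition corresponding_data ::
  "(real ^ 'n::finite) set \<Rightarrow> 'n space_data \<Rightarrow> 'n connection \<Rightarrow> 'n space_data \<Rightarrow> bool" where
  "corresponding_data M a Lbar b \<longleftrightarrow> coeff b = Lbar \<and> admissible_data M b
     \<and> (\<forall>x\<in>M. \<forall>i j k. 2 * sig b j k x * phi b i x = - (2 * sig a j k x * phi a i x))"

text \<open>
  Objects depending on \<open>\<nu>\<close> and \<open>\<mu>\<close> have the same form in the target space only if that space
  has its own \<open>\<nu>\<close> and \<open>\<mu>\<close>, i.e. if the inverse mapping satisfies basic equations as well.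
\<close>

definition inverse_data ::
  "(real ^ 'n::finite) set \<Rightarrow> 'n space_data \<Rightarrow> 'n connection \<Rightarrow> 'n space_data \<Rightarrow> bool" where
  "inverse_data M a Lbar b \<longleftrightarrow>
     corresponding_data M a Lbar b \<and> (\<exists>\<psi>'. pi3_mapping M \<psi>' b (coeff a))"


section \<open>Total and valued invariance\<close>

text \<open>
  A geometrical object is given by its form: a function \<open>U\<close> that sends the objects of a space and a
  point to the array of components.  \<open>C\<close> tells which objects of the target space are inserted into
  the same form: \<open>corresponding_data\<close> for forms without \<open>\<nu>, \<mu>\<close>, \<open>inverse_data\<close> otherwise.
\<close>

definition total_invariance ::
  "((real ^ 'n::finite) set \<Rightarrow> 'n space_data \<Rightarrow> 'n connection \<Rightarrow> 'n space_data \<Rightarrow> bool) \<Rightarrow>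
   (real ^ 'n) set \<Rightarrow> 'n space_data \<Rightarrow> 'n connection \<Rightarrow> ('n space_data \<Rightarrow> real ^ 'n \<Rightarrow> 'c) \<Rightarrow> bool" where
  "total_invariance C M a Lbar U \<longleftrightarrow>
     (\<exists>b. C M a Lbar b) \<and> (\<forall>b. C M a Lbar b \<longrightarrow> (\<forall>x\<in>M. U b x = U a x))"

definition jet where
  "jet (b :: ('n::finite) space_data) x =
     ((\<lambda>i j k. coeff b i j k x), (\<lambda>i j k l. partial l (coeff b i j k) x),
      (\<lambda>j k. sig b j k x), (\<lambda>j k l. partial l (sig b j k) x),
      (\<lambda>i. phi b i x), (\<lambda>i l. partial l (phi b i) x))"

text \<open>
  The value is preserved, possibly in another form \<open>V\<close>: an expression in the connection
  coefficients, \<open>\<sigma>\<close>, \<open>\<phi>\<close> of the target space and their first partial derivatives.  \<open>V\<close> must be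
  the same for all mappings of the class; for a single mapping the condition would be void.
\<close>

definition valued_invariance :: "(('n::finite) space_data \<Rightarrow> real ^ 'n \<Rightarrow> 'c) \<Rightarrow> bool" where
  "valued_invariance U \<longleftrightarrow> (\<exists>V. \<forall>M \<psi> a Lbar b.
     open M \<and> equitorsion_pi3_mapping M \<psi> a Lbar \<and> corresponding_data M a Lbar b \<longrightarrow>
       (\<forall>x\<in>M. U a x = V (jet b x)))"


section \<open>The geometrical objects\<close>

definition theta :: "('n::finite) space_data \<Rightarrow> 'n covector_field" where
  "theta a j x = (\<Sum>\<alpha>\<in>UNIV. symm (coeff a) \<alpha> j \<alpha> x) + (\<Sum>\<alpha>\<in>UNIV. sig a j \<alpha> x * phi a \<alpha> x)"

definition thomas :: "('n::finite) space_data \<Rightarrow> real ^ 'n \<Rightarrow> 'n \<Rightarrow> 'n \<Rightarrow> 'n \<Rightarrow> real" where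
  "thomas a x i j k = (let N = real CARD('n) in
     symm (coeff a) i j k x
     - 1 / (N + 1) * delta i k * theta a j x - 1 / (N + 1) * delta i j * theta a k x
     + sig a j k x * phi a i x)"

text \<open>
  \<open>(\<sigma>\<^sub>[\<^sub>m\<^sub>\<alpha>\<^sub>|\<^sub>n\<^sub>] - \<sigma>\<^sub>[\<^sub>m\<^sub>\<beta> L\<^sup>\<beta>\<^sub>\<alpha>\<^sub>n\<^sub>] + \<sigma>\<^sub>[\<^sub>m\<^sub>\<alpha> \<nu>\<^sub>n\<^sub>]) \<phi>\<^sup>\<alpha>\<close> with the skew part of \<open>L\<close>; by the second
  basic equation this is the exterior derivative of the 1-form \<open>\<sigma>\<^sub>m\<^sub>\<alpha> \<phi>\<^sup>\<alpha>\<close>, up to sign.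
\<close>

definition sigma_phi_curl :: "('n::finite) space_data \<Rightarrow> real ^ 'n \<Rightarrow> 'n \<Rightarrow> 'n \<Rightarrow> real" where
  "sigma_phi_curl a x m n =
     (let \<sigma> = (\<lambda>j k. sig a j k x); d\<sigma> = (\<lambda>j k l. cov02 (coeff a) (sig a) j k l x);
          \<phi> = (\<lambda>i. phi a i x); \<nu> = (\<lambda>j. nu a j x); A = (\<lambda>i j k. tors (coeff a) i j k x)
      in \<Sum>\<alpha>\<in>UNIV. (brack (\<lambda>m n. d\<sigma> m \<alpha> n) m n
            - (\<Sum>\<beta>\<in>UNIV. brack (\<lambda>m n. \<sigma> m \<beta> * A \<beta> \<alpha> n) m n)
            + brack (\<lambda>m n. \<sigma> m \<alpha> * \<nu> n) m n) * \<phi> \<alpha>)"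

definition assoc_inv :: "('n::finite) space_data \<Rightarrow> real ^ 'n \<Rightarrow> 'n \<Rightarrow> 'n \<Rightarrow> 'n \<Rightarrow> 'n \<Rightarrow> real" where
  "assoc_inv a x i j m n =
     (let N = real CARD('n); L = coeff a;
          \<sigma> = (\<lambda>j k. sig a j k x); d\<sigma> = (\<lambda>j k l. cov02 L (sig a) j k l x);
          \<phi> = (\<lambda>i. phi a i x); \<nu> = (\<lambda>j. nu a j x); \<mu> = mu a x; A = (\<lambda>i j k. tors L i j k x);
          Ric = (\<lambda>i j. ricci L i j x); \<delta> = delta
      in curvature L i j m n x
         + 1 / (N + 1) * \<delta> i j * (brack Ric m n - sigma_phi_curl a x m n)
         + brack (\<lambda>m n. d\<sigma> j m n) m n * \<phi> i
         + (\<Sum>\<alpha>\<in>UNIV. brack (\<lambda>m n. \<sigma> j m * \<sigma> \<alpha> n) m n * \<phi> \<alpha> * \<phi> i)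
         - (\<Sum>\<alpha>\<in>UNIV. brack (\<lambda>m n. \<sigma> j m * A i \<alpha> n) m n * \<phi> \<alpha>)
         + brack (\<lambda>m n. \<sigma> j m * \<nu> n) m n * \<phi> i
         - brack (\<lambda>m n. \<delta> i m * \<mu> * \<sigma> j n) m n
         - 1 / (N + 1) *
             (brack (\<lambda>m n. \<delta> i m * (\<Sum>\<alpha>\<in>UNIV. cov12 L (symm L) \<alpha> j \<alpha> n x)) m n
              + (\<Sum>\<alpha>\<in>UNIV. (brack (\<lambda>m n. \<delta> i m * d\<sigma> j \<alpha> n) m n
                  - (\<Sum>\<beta>\<in>UNIV. brack (\<lambda>m n. \<delta> i m * \<sigma> j \<beta> * A \<beta> \<alpha> n) m n)
                  + brack (\<lambda>m n. \<delta> i m * \<sigma> j \<alpha> * \<nu> n) m n) * \<phi> \<alpha>)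
              + brack (\<lambda>m n. \<delta> i m * \<mu> * \<sigma> j n) m n)
         + 1 / (N + 1) * brack (\<lambda>m n. \<delta> i m * \<sigma> j n) m n * (\<Sum>\<alpha>\<in>UNIV. theta a \<alpha> x * \<phi> \<alpha>)
         - 1 / (N + 1)\<^sup>2 * theta a j x *
             (brack (\<lambda>m n. \<delta> i m * (\<Sum>\<beta>\<in>UNIV. symm L \<beta> n \<beta> x)) m n
              + (\<Sum>\<beta>\<in>UNIV. brack (\<lambda>m n. \<delta> i m * \<sigma> n \<beta>) m n * \<phi> \<beta>)))"

text \<open>
  The formula of the source for the derived invariant of the Weyl type, unchanged.
\<close>

definition weyl_inv_printed :: "('n::finite) space_data \<Rightarrow> real ^ 'n \<Rightarrow> 'n \<Rightarrow> 'n \<Rightarrow> 'n \<Rightarrow> 'n \<Rightarrow> real" where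
  "weyl_inv_printed a x i j m n =
     (let N = real CARD('n); L = coeff a;
          \<sigma> = (\<lambda>j k. sig a j k x); d\<sigma> = (\<lambda>j k l. cov02 L (sig a) j k l x);
          \<phi> = (\<lambda>i. phi a i x); \<nu> = (\<lambda>j. nu a j x); A = (\<lambda>i j k. tors L i j k x);
          Ric = (\<lambda>i j. ricci L i j x); \<delta> = delta
      in curvature L i j m n x
         + 1 / (N + 1) * \<delta> i j * brack Ric m n
         + N / (N\<^sup>2 - 1) * brack (\<lambda>m n. \<delta> i m * Ric j n) m n
         + 1 / (N\<^sup>2 - 1) * brack (\<lambda>m n. \<delta> i m * Ric n j) m n
         + brack (\<lambda>m n. d\<sigma> j m n) m n * \<phi> i
         - (\<Sum>\<alpha>\<in>UNIV. brack (\<lambda>m n. \<sigma> j m * A i \<alpha> n) m n * \<phi> \<alpha>)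
         + brack (\<lambda>m n. \<sigma> j m * \<nu> n) m n * \<phi> i
         + (\<Sum>\<alpha>\<in>UNIV. brack (\<lambda>m n. \<sigma> j m * \<sigma> \<alpha> n) m n * \<phi> \<alpha> * \<phi> i)
         + 1 / (N - 1) *
             (\<Sum>\<alpha>\<in>UNIV. (brack (\<lambda>m n. \<delta> i m * d\<sigma> j n \<alpha>) m n
                - (\<Sum>\<beta>\<in>UNIV. brack (\<lambda>m n. \<delta> i m * \<sigma> j n) m n * A \<beta> \<alpha> \<beta>)
                + brack (\<lambda>m n. \<delta> i m * \<sigma> j n) m n * \<nu> \<alpha>) * \<phi> \<alpha>)
         + 1 / (N - 1) *
             (\<Sum>\<alpha>\<in>UNIV. \<Sum>\<beta>\<in>UNIV. (brack (\<lambda>m n. \<delta> i m * \<sigma> j n) m n * \<sigma> \<alpha> \<beta>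
                - brack (\<lambda>m n. \<delta> i m * \<sigma> j \<alpha> * \<sigma> n \<beta>) m n) * \<phi> \<alpha> * \<phi> \<beta>)
         - N / (N\<^sup>2 - 1) *
             (\<Sum>\<alpha>\<in>UNIV. (brack (\<lambda>m n. \<delta> i m * d\<sigma> \<alpha> j n) m n
                - (\<Sum>\<beta>\<in>UNIV. brack (\<lambda>m n. \<delta> i m * \<sigma> \<beta> j * A \<beta> \<alpha> n) m n)
                + brack (\<lambda>m n. \<delta> i m * \<sigma> \<alpha> j * \<nu> n) m n) * \<phi> \<alpha>)
         - 1 / (N\<^sup>2 - 1) *
             (\<Sum>\<alpha>\<in>UNIV. (brack (\<lambda>m n. \<delta> i m * d\<sigma> \<alpha> n j) m n
                - (\<Sum>\<beta>\<in>UNIV. brack (\<lambda>m n. \<delta> i m * \<sigma> \<beta> n) m n * A \<beta> \<alpha> j)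
                + brack (\<lambda>m n. \<delta> i m * \<sigma> \<alpha> n) m n * \<nu> j) * \<phi> \<alpha>))"

text \<open>
  \<open>weyl_inv\<close> is the Weyl tensor of the symmetric connection with coefficients
  \<open>L\<^sup>i\<^sub>j\<^sub>k + \<sigma>\<^sub>j\<^sub>k \<phi>\<^sup>i\<close>, \<open>L\<close> being symmetrized.  The formula of the source lacks the summand
  with \<open>sigma_phi_curl\<close>, which it does have in the basic associated invariant.  Since
  \<open>sigma_phi_curl\<close> changes sign under the mapping, the object without this summand is invariant in
  total only where \<open>sigma_phi_curl\<close> vanishes.
\<close>

definition weyl_inv :: "('n::finite) space_data \<Rightarrow> real ^ 'n \<Rightarrow> 'n \<Rightarrow> 'n \<Rightarrow> 'n \<Rightarrow> 'n \<Rightarrow> real" where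
  "weyl_inv a x i j m n = weyl_inv_printed a x i j m n
     - 1 / (real CARD('n) + 1) * delta i j * sigma_phi_curl a x m n"

definition omega :: "('n::finite) space_data \<Rightarrow> real ^ 'n \<Rightarrow> 'n \<Rightarrow> 'n \<Rightarrow> 'n \<Rightarrow> real" where
  "omega a x i j k = (let N = real CARD('n) in
     1 / (N + 1) * delta i k * theta a j x + 1 / (N + 1) * delta i j * theta a k x
     - sig a j k x * phi a i x)"

definition omega_sel :: "nat \<Rightarrow> ('n::finite) space_data \<Rightarrow> real ^ 'n \<Rightarrow> 'n \<Rightarrow> 'n \<Rightarrow> 'n \<Rightarrow> real" where
  "omega_sel p a x i j k = (if p = 1 then symm (coeff a) i j k x else omega a x i j k)"

definition torsion_part ::
  "real \<Rightarrow> real \<Rightarrow> nat \<times> nat \<times> nat \<Rightarrow> nat \<times> nat \<times> nat \<Rightarrow>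
   ('n::finite) space_data \<Rightarrow> real ^ 'n \<Rightarrow> 'n \<Rightarrow> 'n \<Rightarrow> 'n \<Rightarrow> 'n \<Rightarrow> real" where
  "torsion_part u u' p q a x i j m n =
     (let L = coeff a; A = (\<lambda>i j k. tors L i j k x); (p1, p2, p3) = p; (q1, q2, q3) = q
      in u * cov12 L (tors L) i j m n x + u' * cov12 L (tors L) i j n m x
         - u * ((\<Sum>\<alpha>\<in>UNIV. omega_sel p1 a x i \<alpha> n * A \<alpha> j m)
              - (\<Sum>\<alpha>\<in>UNIV. omega_sel p2 a x \<alpha> j n * A i \<alpha> m)
              - (\<Sum>\<alpha>\<in>UNIV. omega_sel p3 a x \<alpha> m n * A i j \<alpha>))
         - u' * ((\<Sum>\<alpha>\<in>UNIV. omega_sel q1 a x i \<alpha> m * A \<alpha> j n)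
              - (\<Sum>\<alpha>\<in>UNIV. omega_sel q2 a x \<alpha> j m * A i \<alpha> n)
              - (\<Sum>\<alpha>\<in>UNIV. omega_sel q3 a x \<alpha> m n * A i j \<alpha>)))"

definition with_torsion ::
  "(('n::finite) space_data \<Rightarrow> real ^ 'n \<Rightarrow> 'n \<Rightarrow> 'n \<Rightarrow> 'n \<Rightarrow> 'n \<Rightarrow> real) \<Rightarrow>
   real \<Rightarrow> real \<Rightarrow> nat \<times> nat \<times> nat \<Rightarrow> nat \<times> nat \<times> nat \<Rightarrow>
   'n space_data \<Rightarrow> real ^ 'n \<Rightarrow> 'n \<Rightarrow> 'n \<Rightarrow> 'n \<Rightarrow> 'n \<Rightarrow> real" where
  "with_torsion W u u' p q a x i j m n = W a x i j m n + torsion_part u u' p q a x i j m n"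

end

theory Submission
  imports Defs
begin

text \<open>
  Let \<open>T\<^sup>i\<^sub>j\<^sub>k = L\<^sup>i\<^sub>j\<^sub>k + \<sigma>\<^sub>j\<^sub>k \<phi>\<^sup>i\<close>, where \<open>L\<close> is symmetrized.  The first basic equation adds
  \<open>2 \<sigma>\<^sub>j\<^sub>k \<phi>\<^sup>i\<close> and a projective term with \<open>\<psi>\<close> to \<open>L\<close>, while \<open>\<sigma>\<^sub>j\<^sub>k \<phi>\<^sup>i\<close> changes its sign.  So \<open>T\<close>
  changes by the projective term \<open>\<psi>\<^sub>j \<delta>\<^sup>i\<^sub>k + \<psi>\<^sub>k \<delta>\<^sup>i\<^sub>j\<close> alone, and every projective invariant of the
  symmetric connection \<open>T\<close> is an invariant of the mapping.

  The invariants of the claim are of this kind.  The object \<^const>\<open>thomas\<close> is the trace-free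
  connection in the projective class of \<open>T\<close> (\<open>thomas_eq\<close>).  Once the derivatives of \<open>\<phi>\<close> are
  eliminated by the second basic equation, \<^const>\<open>assoc_inv\<close> is the curvature of that connection
  (\<open>assoc_inv_eq\<close>) and \<^const>\<open>weyl_inv\<close> is the Weyl tensor of \<open>T\<close> (\<open>weyl_inv_eq\<close>).  Both are therefore
  determined by the first jet of \<^const>\<open>thomas\<close>.  The torsion parts are determined by this jet
  and that of the torsion, which an equitorsion mapping preserves as well, because \<open>\<omega>\<close> differs from
  the connection by \<^const>\<open>thomas\<close> only (\<open>thomas_determined_torsion_part\<close>).  The object
  \<^const>\<open>weyl_inv_printed\<close> differs from \<^const>\<open>weyl_inv\<close> by a multiple of the exterior derivative of the
  1-form \<open>\<sigma>\<^sub>j\<^sub>\<alpha> \<phi>\<^sup>\<alpha>\<close>, which changes sign; this is the reason for the additional condition for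
  its total invariance.

  The jet of \<^const>\<open>thomas\<close> is the same for any corresponding data of the target space and is an
  expression in the connection coefficients, \<open>\<sigma>\<close>, \<open>\<phi>\<close> and their first derivatives.  This yields valued
  invariance, with a form that does not contain \<open>\<nu>, \<mu>\<close> of the target space.  The form can be the
  original one only if the target space has \<open>\<nu>, \<mu>\<close> of its own, i.e. if the mapping is reciprocal.
  An equitorsion mapping always is: \<open>\<phi>\<close> satisfies the second basic equation in the target space,
  with \<open>\<nu>\<^sub>j + \<psi>\<^sub>j + 2 \<sigma>\<^sub>\<alpha>\<^sub>j \<phi>\<^sup>\<alpha>\<close> and \<open>\<mu> + \<psi>\<^sub>\<alpha> \<phi>\<^sup>\<alpha>\<close> in place of \<open>\<nu>\<^sub>j\<close> and \<open>\<mu>\<close>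
  (\<open>ex_inverse_data\<close>).
\<close>

section \<open>Partial derivatives and smooth functions\<close>

lemma partial_has_derivative:
  assumes "(f has_derivative f') (at x)"
  shows "partial k f x = f' (axis k 1)"
  unfolding partial_def using frechet_derivative_at[OF assms] by simp

text \<open>
  Objects of the two spaces agree on the coordinate domain only, but since the domain is open their
  partial derivatives agree there as well.
\<close>

lemma partial_cong_open:
  assumes "open M" "x \<in> M" "\<And>y. y \<in> M \<Longrightarrow> f y = g y"
  shows "partial k f x = partial k g x"
proof -
  have "(f has_derivative D) (at x) \<longleftrightarrow> (g has_derivative D) (at x)" for D
    using assms by (metis has_derivative_transform_within_open)
  then show ?thesis
    unfolding partial_def frechet_derivative_def by presburger
qed

lemma partial_add:
  assumes "f differentiable (at x)" "g differentiable (at x)"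
  shows "partial k (\<lambda>y. f y + g y) x = partial k f x + partial k g x"
  using partial_has_derivative[OF has_derivative_add[OF assms[unfolded frechet_derivative_works]]]
  by (simp add: partial_def)

lemma partial_mult:
  assumes "f differentiable (at x)" "g differentiable (at x)"
  shows "partial k (\<lambda>y. f y * g y) x = partial k f x * g x + f x * partial k g x"
  using partial_has_derivative[OF has_derivative_mult[OF assms[unfolded frechet_derivative_works]]]
  by (simp add: partial_def)

lemma partial_const [simp]: "partial k (\<lambda>y. c) x = 0"
  by (rule partial_has_derivative[OF has_derivative_const])

lemma partial_cmult:
  assumes "f differentiable (at x)"
  shows "partial k (\<lambda>y. c * f y) x = c * partial k f x"
  by (simp add: partial_mult[OF differentiable_const assms])

lemma partial_sum:
  assumes "finite I" "\<And>i. i \<in> I \<Longrightarrow> f i differentiable (at x)"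
  shows "partial k (\<lambda>y. \<Sum>i\<in>I. f i y) x = (\<Sum>i\<in>I. partial k (f i) x)"
  using assms by (induction I) (simp_all add: partial_add differentiable_sum)

lemma Ck_cong_open:
  assumes "open M" "\<And>x. x \<in> M \<Longrightarrow> f x = g x"
  shows "Ck r M f \<longleftrightarrow> Ck r M g"
  using assms(2)
proof (induction r arbitrary: f g)
  case 0
  then show ?case by (simp cong: continuous_on_cong)
next
  case (Suc r)
  have "f differentiable (at x) \<longleftrightarrow> g differentiable (at x)" if "x \<in> M" for x
    unfolding differentiable_def
    using that assms(1) Suc.prems by (metis has_derivative_transform_within_open)
  moreover have "Ck r M (partial k f) \<longleftrightarrow> Ck r M (partial k g)" for k
    using Suc partial_cong_open[OF assms(1)] by blast
  ultimately show ?case by simp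
qed

lemma Ck_Suc_imp_Ck: "Ck (Suc r) M f \<Longrightarrow> Ck r M f"
proof (induction r arbitrary: f)
  case 0
  then show ?case
    by (simp add: continuous_at_imp_continuous_on differentiable_imp_continuous_within)
qed auto

lemma Ck_const: "Ck r M (\<lambda>y. c)"
proof (induction r arbitrary: c)
  case (Suc r)
  have "partial k (\<lambda>y. c) = (\<lambda>y. 0)" for k :: 'a by (rule ext) simp
  then show ?case using Suc by simp
qed simp

lemma Ck_add:
  assumes "open M"
  shows "Ck r M f \<Longrightarrow> Ck r M g \<Longrightarrow> Ck r M (\<lambda>y. f y + g y)"
proof (induction r arbitrary: f g)
  case (Suc r)
  have "Ck r M (partial k (\<lambda>y. f y + g y))" for k
    using Suc by (subst Ck_cong_open[OF assms, of _ "\<lambda>y. partial k f y + partial k g y"])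
      (simp_all add: partial_add)
  then show ?case using Suc.prems by simp
qed (simp add: continuous_on_add)

lemma Ck_mult:
  assumes "open M"
  shows "Ck r M f \<Longrightarrow> Ck r M g \<Longrightarrow> Ck r M (\<lambda>y. f y * g y)"
proof (induction r arbitrary: f g)
  case (Suc r)
  have "Ck r M (partial k (\<lambda>y. f y * g y))" for k
    using Suc Ck_Suc_imp_Ck[of r M f] Ck_Suc_imp_Ck[of r M g]
    by (subst Ck_cong_open[OF assms, of _ "\<lambda>y. partial k f y * g y + f y * partial k g y"])
      (simp_all add: partial_mult Ck_add[OF assms])
  then show ?case using Suc.prems by simp
qed (simp add: continuous_on_mult)

lemma smooth_const: "smooth M (\<lambda>y. c)"
  by (simp add: smooth_def Ck_const)

lemma smooth_add: "open M \<Longrightarrow> smooth M f \<Longrightarrow> smooth M g \<Longrightarrow> smooth M (\<lambda>y. f y + g y)"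
  by (simp add: smooth_def Ck_add)

lemma smooth_mult: "open M \<Longrightarrow> smooth M f \<Longrightarrow> smooth M g \<Longrightarrow> smooth M (\<lambda>y. f y * g y)"
  by (simp add: smooth_def Ck_mult)

lemma smooth_uminus: "open M \<Longrightarrow> smooth M f \<Longrightarrow> smooth M (\<lambda>y. - f y)"
  using smooth_mult[OF _ smooth_const[of _ "-1"]] by fastforce

lemma smooth_sum:
  assumes "open M" "finite I" "\<And>i. i \<in> I \<Longrightarrow> smooth M (f i)"
  shows "smooth M (\<lambda>y. \<Sum>i\<in>I. f i y)"
  using assms(2,3) by (induction I) (simp_all add: smooth_const smooth_add[OF assms(1)])

lemma smooth_imp_differentiable: "smooth M f \<Longrightarrow> x \<in> M \<Longrightarrow> f differentiable (at x)"
  unfolding smooth_def by (metis Ck.simps(2))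

section \<open>Curvature of a deformed connection at a point\<close>

text \<open>
  The curvature formula is an expression in the coefficients \<open>S\<close> of a connection and their first
  partial derivatives \<open>dS\<close>.  Treating the values of both at a point as unrelated arrays turns the
  effect of a deformation of the connection into an identity of finite sums.
\<close>

definition curv ::
  "('n::finite \<Rightarrow> 'n \<Rightarrow> 'n \<Rightarrow> real) \<Rightarrow> ('n \<Rightarrow> 'n \<Rightarrow> 'n \<Rightarrow> 'n \<Rightarrow> real) \<Rightarrow> 'n \<Rightarrow> 'n \<Rightarrow> 'n \<Rightarrow> 'n \<Rightarrow> real" where
  "curv S dS i j m n = dS i j m n - dS i j n m
     + (\<Sum>\<alpha>\<in>UNIV. S \<alpha> j m * S i \<alpha> n) - (\<Sum>\<alpha>\<in>UNIV. S \<alpha> j n * S i \<alpha> m)"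

lemma delta_refl [simp]: "delta i i = 1"
  by (simp add: delta_def)

lemma sum_delta [simp]:
  fixes f :: "'n::finite \<Rightarrow> real"
  shows "(\<Sum>\<alpha>\<in>UNIV. delta i \<alpha> * f \<alpha>) = f i" "(\<Sum>\<alpha>\<in>UNIV. delta \<alpha> i * f \<alpha>) = f i"
    "(\<Sum>\<alpha>\<in>UNIV. f \<alpha> * delta i \<alpha>) = f i" "(\<Sum>\<alpha>\<in>UNIV. f \<alpha> * delta \<alpha> i) = f i"
  by (simp_all add: delta_def if_distrib[of "\<lambda>c. c * _"] if_distrib[of "\<lambda>c. _ * c"] cong: if_cong)

text \<open>
  \<open>P\<close> is the covariant derivative of \<open>p\<close> less \<open>p \<otimes> p\<close>.  The quadratic terms of the curvature that
  contain the trace-like part \<open>p\<^sub>j \<delta>\<^sup>i\<^sub>k + p\<^sub>k \<delta>\<^sup>i\<^sub>j\<close> either are symmetric in \<open>m, n\<close> and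
  cancel or combine with the derivatives of \<open>p\<close> to \<open>P\<close>.
\<close>

lemma curv_projective_change:
  fixes S :: "'n::finite \<Rightarrow> 'n \<Rightarrow> 'n \<Rightarrow> real"
  assumes sym: "\<And>i j k. S i j k = S i k j"
    and S': "\<And>i j k. S' i j k = S i j k + p j * delta i k + p k * delta i j"
    and dS': "\<And>i j k l. dS' i j k l = dS i j k l + dp j l * delta i k + dp k l * delta i j"
    and P: "\<And>j n. P j n = dp j n - (\<Sum>\<alpha>\<in>UNIV. S \<alpha> j n * p \<alpha>) - p j * p n"
  shows "curv S' dS' i j m n
    = curv S dS i j m n + delta i j * (P m n - P n m) + delta i m * P j n - delta i n * P j m"
proof -
  have prod: "(\<Sum>\<alpha>\<in>UNIV. S' \<alpha> j m * S' i \<alpha> n) = (\<Sum>\<alpha>\<in>UNIV. S \<alpha> j m * S i \<alpha> n)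
      + (\<Sum>\<alpha>\<in>UNIV. S \<alpha> j m * p \<alpha>) * delta i n + p n * S i j m + p j * S i m n + p j * p m * delta i n
      + p j * p n * delta i m + p m * S i j n + p m * p j * delta i n + p m * p n * delta i j" for m n
  proof -
    have "S' \<alpha> j m * S' i \<alpha> n = S \<alpha> j m * S i \<alpha> n
      + S \<alpha> j m * p \<alpha> * delta i n + p n * S \<alpha> j m * delta i \<alpha>
      + p j * S i \<alpha> n * delta \<alpha> m + p j * p \<alpha> * delta i n * delta \<alpha> m
      + p j * p n * delta i \<alpha> * delta \<alpha> m
      + p m * S i \<alpha> n * delta \<alpha> j + p m * p \<alpha> * delta i n * delta \<alpha> j
      + p m * p n * delta i \<alpha> * delta \<alpha> j" for \<alpha>
      by (simp add: S' algebra_simps)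
    then show ?thesis
      by (simp add: sum.distrib sum_distrib_right)
  qed
  have "(\<Sum>\<alpha>\<in>UNIV. S \<alpha> m n * p \<alpha>) = (\<Sum>\<alpha>\<in>UNIV. S \<alpha> n m * p \<alpha>)"
    by (simp add: sym[of _ m n])
  then show ?thesis
    unfolding curv_def prod dS' P by (simp add: sym[of _ m n] algebra_simps)
qed

text \<open>
  A deformation by \<open>s\<^sub>j\<^sub>k f\<^sup>i\<close> adds its covariant derivative, antisymmetrized, and a quadratic
  term.  By the product rule the covariant derivative is expressed by those of the factors, \<open>cs\<close> and
  \<open>cf\<close>; the terms that correct the second index of \<open>s\<close> cancel, because \<open>S\<close> is symmetric.
\<close>

lemma curv_add_product:
  fixes S :: "'n::finite \<Rightarrow> 'n \<Rightarrow> 'n \<Rightarrow> real"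
  assumes sym: "\<And>i j k. S i j k = S i k j" "\<And>j k. s j k = s k j"
    and S': "\<And>i j k. S' i j k = S i j k + s j k * f i"
    and dS': "\<And>i j k l. dS' i j k l = dS i j k l + ds j k l * f i + s j k * df i l"
    and cs: "\<And>j m n. cs j m n = ds j m n - (\<Sum>\<alpha>\<in>UNIV. S \<alpha> j n * s \<alpha> m) - (\<Sum>\<alpha>\<in>UNIV. S \<alpha> m n * s j \<alpha>)"
    and cf: "\<And>i n. cf i n = df i n + (\<Sum>\<alpha>\<in>UNIV. S i \<alpha> n * f \<alpha>)"
  shows "curv S' dS' i j m n = curv S dS i j m n + (cs j m n - cs j n m) * f i
    + s j m * cf i n - s j n * cf i m
    + (\<Sum>\<alpha>\<in>UNIV. (s j m * s \<alpha> n - s j n * s \<alpha> m) * f \<alpha> * f i)"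
proof -
  have prod: "(\<Sum>\<alpha>\<in>UNIV. S' \<alpha> j m * S' i \<alpha> n) = (\<Sum>\<alpha>\<in>UNIV. S \<alpha> j m * S i \<alpha> n)
     + (\<Sum>\<alpha>\<in>UNIV. S \<alpha> j m * s \<alpha> n) * f i + s j m * (\<Sum>\<alpha>\<in>UNIV. S i \<alpha> n * f \<alpha>)
     + (\<Sum>\<alpha>\<in>UNIV. s j m * s \<alpha> n * f \<alpha> * f i)" for m n
    by (simp add: S' sum.distrib sum_distrib_left sum_distrib_right algebra_simps)
  have "(\<Sum>\<alpha>\<in>UNIV. S \<alpha> m n * s j \<alpha>) = (\<Sum>\<alpha>\<in>UNIV. S \<alpha> n m * s j \<alpha>)"
    by (simp add: sym(1)[of _ m n])
  then show ?thesis
    unfolding curv_def prod dS' cs cf by (simp add: algebra_simps sum_subtractf)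
qed

text \<open>The projective Weyl tensor as a linear function of the curvature tensor.\<close>

definition weyl_of :: "('n::finite \<Rightarrow> 'n \<Rightarrow> 'n \<Rightarrow> 'n \<Rightarrow> real) \<Rightarrow> 'n \<Rightarrow> 'n \<Rightarrow> 'n \<Rightarrow> 'n \<Rightarrow> real" where
  "weyl_of R i j m n =
     (let N = real CARD('n); Ric = (\<lambda>j m. \<Sum>\<alpha>\<in>UNIV. R \<alpha> j m \<alpha>)
      in R i j m n + 1 / (N + 1) * delta i j * brack Ric m n
         + N / (N\<^sup>2 - 1) * brack (\<lambda>m n. delta i m * Ric j n) m n
         + 1 / (N\<^sup>2 - 1) * brack (\<lambda>m n. delta i m * Ric n j) m n)"

text \<open>
  The deformation by \<open>P\<close> changes the Ricci tensor by \<open>P\<^sub>m\<^sub>j - N P\<^sub>j\<^sub>m\<close>.  The coefficients of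
  \<^const>\<open>weyl_of\<close> are those for which this cancels the change of the curvature; \<open>N > 1\<close> makes
  \<open>N\<^sup>2 - 1\<close> invertible.
\<close>

lemma weyl_of_projective_change:
  fixes R :: "'n::finite \<Rightarrow> 'n \<Rightarrow> 'n \<Rightarrow> 'n \<Rightarrow> real"
  assumes "CARD('n) > 1"
    and R': "\<And>i j m n. R' i j m n
      = R i j m n + delta i j * (P m n - P n m) + delta i m * P j n - delta i n * P j m"
  shows "weyl_of R' i j m n = weyl_of R i j m n"
proof -
  define N where "N = real CARD('n)"
  have N: "N + 1 \<noteq> 0" "N\<^sup>2 - 1 = (N - 1) * (N + 1)" "N - 1 \<noteq> 0"
    using assms(1) by (auto simp: N_def power2_eq_square algebra_simps)
  have Ric: "(\<Sum>\<alpha>\<in>UNIV. R' \<alpha> j m \<alpha>) = (\<Sum>\<alpha>\<in>UNIV. R \<alpha> j m \<alpha>) + P m j - N * P j m" for j m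
    by (simp add: R' N_def sum.distrib sum_subtractf right_diff_distrib)
  show ?thesis
    unfolding weyl_of_def Let_def brack_def Ric
    unfolding R' N_def[symmetric] N(2)
    using N(1,3) by (simp add: divide_simps) algebra
qed

section \<open>The objects of a space and their derivatives\<close>

text \<open>
  The second basic equation says that \<open>\<phi>\<close> is a torse-forming vector field.
\<close>

definition torse_forming :: "(real ^ 'n::finite) set \<Rightarrow> 'n space_data \<Rightarrow> bool" where
  "torse_forming M a \<longleftrightarrow> admissible_data M a
     \<and> (\<forall>x\<in>M. \<forall>i j. cov_first_kind (coeff a) (phi a) i j x = nu a j x * phi a i x + mu a x * delta i j)"

definition sigma_phi :: "('n::finite) space_data \<Rightarrow> 'n covector_field" where
  "sigma_phi a j x = (\<Sum>\<alpha>\<in>UNIV. sig a j \<alpha> x * phi a \<alpha> x)"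

text \<open>
  For a torse-forming \<open>\<phi>\<close> this is the covariant derivative of the 1-form \<^const>\<open>sigma_phi\<close> in the
  associated space less \<open>\<mu> \<sigma>\<^sub>j\<^sub>n\<close>.  It is the combination of \<open>\<sigma>, \<nu>\<close> and the torsion that
  occurs repeatedly in the invariants.
\<close>

definition sigma_phi_deriv :: "('n::finite) space_data \<Rightarrow> real ^ 'n \<Rightarrow> 'n \<Rightarrow> 'n \<Rightarrow> real" where
  "sigma_phi_deriv a x j n = (\<Sum>\<alpha>\<in>UNIV. (cov02 (coeff a) (sig a) j \<alpha> n x
     - (\<Sum>\<beta>\<in>UNIV. sig a j \<beta> x * tors (coeff a) \<beta> \<alpha> n x) + sig a j \<alpha> x * nu a n x) * phi a \<alpha> x)"

text \<open>
  Up to a projective change, this is the mean of the symmetric connections of the two spaces of a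
  mapping with these data.
\<close>

definition middle_connection :: "('n::finite) space_data \<Rightarrow> 'n connection" where
  "middle_connection a i j k x = symm (coeff a) i j k x + sig a j k x * phi a i x"

definition curv_at :: "('n::finite) connection \<Rightarrow> 'n \<Rightarrow> 'n \<Rightarrow> 'n \<Rightarrow> 'n \<Rightarrow> 'n scalar_field" where
  "curv_at S i j m n x = curv (\<lambda>i j k. S i j k x) (\<lambda>i j k l. partial l (S i j k) x) i j m n"

lemma symm_commute: "symm L i j k = symm L i k j"
  by (rule ext) (simp add: symm_def)


lemma curvature_eq_curv_at: "curvature L = curv_at (symm L)"
  by (intro ext) (simp add: curvature_def curv_at_def curv_def)

lemma theta_eq: "theta a j x = (\<Sum>\<alpha>\<in>UNIV. symm (coeff a) \<alpha> j \<alpha> x) + sigma_phi a j x"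
  by (simp add: theta_def sigma_phi_def)

lemma coeff_eq_symm_plus_tors: "L i j k x = symm L i j k x + tors L i j k x"
  by (simp add: symm_def tors_def field_simps)

lemma thomas_eq:
  fixes a :: "('n::finite) space_data"
  shows "thomas a x i j k = middle_connection a i j k x + (- 1 / (real CARD('n) + 1) * theta a j x) * delta i k
     + (- 1 / (real CARD('n) + 1) * theta a k x) * delta i j"
  by (simp add: thomas_def middle_connection_def Let_def algebra_simps)

context
  fixes M :: "(real ^ 'n::finite) set" and a :: "'n space_data" and x :: "real ^ 'n"
  assumes M: "open M" and adm: "admissible_data M a" and x: "x \<in> M"
begin

lemma differentiable_coeff: "coeff a i j k differentiable (at x)"
  and differentiable_sig: "sig a j k differentiable (at x)"
  and differentiable_phi: "phi a i differentiable (at x)"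
  using adm x by (auto simp: admissible_data_def nonsymmetric_space_def intro!: smooth_imp_differentiable[of M])

lemma sig_sym: "sig a j k x = sig a k j x"
  using adm x by (simp add: admissible_data_def)

lemma partial_sig_sym: "partial l (sig a j k) x = partial l (sig a k j) x"
  using adm x by (intro partial_cong_open[OF M]) (simp_all add: admissible_data_def)

lemma cov02_sig_sym: "cov02 L (sig a) j k l x = cov02 L (sig a) k j l x"
proof -
  have "sig a \<alpha> k x = sig a k \<alpha> x" "sig a j \<alpha> x = sig a \<alpha> j x" for \<alpha>
    by (rule sig_sym)+
  then show ?thesis
    by (simp add: cov02_def partial_sig_sym[of l j k])
qed

lemma differentiable_symm: "symm (coeff a) i j k differentiable (at x)"
proof -
  have "symm (coeff a) i j k = (\<lambda>y. (coeff a i j k y + coeff a i k j y) / 2)"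
    by (simp add: symm_def fun_eq_iff)
  then show ?thesis
    by (simp add: differentiable_coeff)
qed

lemma partial_symm:
  "partial l (symm (coeff a) i j k) x = (partial l (coeff a i j k) x + partial l (coeff a i k j) x) / 2"
proof -
  have "symm (coeff a) i j k = (\<lambda>y. 1 / 2 * (coeff a i j k y + coeff a i k j y))"
    by (simp add: symm_def fun_eq_iff)
  then show ?thesis
    by (simp add: partial_cmult partial_add differentiable_coeff del: times_divide_eq_left)
qed

lemma partial_tors:
  "partial l (tors (coeff a) i j k) x = (partial l (coeff a i j k) x - partial l (coeff a i k j) x) / 2"
proof -
  have "tors (coeff a) i j k = (\<lambda>y. 1 / 2 * (coeff a i j k y + (- 1) * coeff a i k j y))"
    by (simp add: tors_def fun_eq_iff)
  then show ?thesis
    by (simp only: partial_cmult partial_add differentiable_coeff differentiable_mult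
        differentiable_add differentiable_const) simp
qed

lemma partial_sig_phi:
  "partial l (\<lambda>y. sig a j k y * phi a i y) x
     = partial l (sig a j k) x * phi a i x + sig a j k x * partial l (phi a i) x"
  by (simp add: partial_mult differentiable_sig differentiable_phi)

lemma differentiable_sigma_phi: "sigma_phi a j differentiable (at x)"
proof -
  have "sigma_phi a j = (\<lambda>y. \<Sum>\<alpha>\<in>UNIV. sig a j \<alpha> y * phi a \<alpha> y)"
    by (simp add: sigma_phi_def fun_eq_iff)
  then show ?thesis
    by (simp add: differentiable_sum differentiable_sig differentiable_phi)
qed

lemma partial_sigma_phi:
  "partial l (sigma_phi a j) x
     = (\<Sum>\<alpha>\<in>UNIV. partial l (sig a j \<alpha>) x * phi a \<alpha> x + sig a j \<alpha> x * partial l (phi a \<alpha>) x)"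
proof -
  have "sigma_phi a j = (\<lambda>y. \<Sum>\<alpha>\<in>UNIV. sig a j \<alpha> y * phi a \<alpha> y)"
    by (simp add: sigma_phi_def fun_eq_iff)
  then show ?thesis
    by (simp add: partial_sum partial_sig_phi differentiable_sig differentiable_phi)
qed

lemma differentiable_theta: "theta a j differentiable (at x)"
proof -
  have "theta a j = (\<lambda>y. (\<Sum>\<alpha>\<in>UNIV. symm (coeff a) \<alpha> j \<alpha> y) + sigma_phi a j y)"
    by (simp add: theta_eq fun_eq_iff)
  then show ?thesis
    by (simp add: differentiable_sum differentiable_symm differentiable_sigma_phi)
qed

lemma partial_theta:
  "partial l (theta a j) x = (\<Sum>\<alpha>\<in>UNIV. partial l (symm (coeff a) \<alpha> j \<alpha>) x) + partial l (sigma_phi a j) x"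
proof -
  have "theta a j = (\<lambda>y. (\<Sum>\<alpha>\<in>UNIV. symm (coeff a) \<alpha> j \<alpha> y) + sigma_phi a j y)"
    by (simp add: theta_eq fun_eq_iff)
  then show ?thesis
    by (simp add: partial_add partial_sum differentiable_sum differentiable_symm differentiable_sigma_phi)
qed

lemma differentiable_middle: "middle_connection a i j k differentiable (at x)"
proof -
  have "middle_connection a i j k = (\<lambda>y. symm (coeff a) i j k y + sig a j k y * phi a i y)"
    by (simp add: middle_connection_def fun_eq_iff)
  then show ?thesis
    by (simp add: differentiable_symm differentiable_sig differentiable_phi)
qed

lemma partial_middle:
  "partial l (middle_connection a i j k) x = partial l (symm (coeff a) i j k) x
     + partial l (sig a j k) x * phi a i x + sig a j k x * partial l (phi a i) x"
proof -
  have "middle_connection a i j k = (\<lambda>y. symm (coeff a) i j k y + sig a j k y * phi a i y)"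
    by (simp add: middle_connection_def fun_eq_iff)
  then show ?thesis
    by (simp add: partial_add partial_sig_phi differentiable_symm differentiable_sig differentiable_phi)
qed

lemma partial_thomas:
  "partial l (\<lambda>y. thomas a y i j k) x = partial l (middle_connection a i j k) x
     + (- 1 / (real CARD('n) + 1) * partial l (theta a j) x) * delta i k
     + (- 1 / (real CARD('n) + 1) * partial l (theta a k) x) * delta i j"
proof -
  have "(\<lambda>y. thomas a y i j k) = (\<lambda>y. middle_connection a i j k y
     + (- 1 / (real CARD('n) + 1) * delta i k) * theta a j y
     + (- 1 / (real CARD('n) + 1) * delta i j) * theta a k y)"
    by (simp add: thomas_eq fun_eq_iff algebra_simps)
  then show ?thesis
    by (simp only: partial_add partial_cmult differentiable_middle differentiable_theta
        differentiable_add differentiable_mult differentiable_const) (simp add: algebra_simps)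
qed

lemma middle_sym: "middle_connection a i j k x = middle_connection a i k j x"
  by (simp add: middle_connection_def sig_sym[of j k] symm_def)

text \<open>
  The Thomas object is the trace-free connection in the projective class of the middle connection,
  obtained from it with the 1-form \<open>- \<theta> / (N + 1)\<close>.
\<close>

lemma curv_at_thomas:
  fixes P
  defines "N \<equiv> real CARD('n)"
  defines "P \<equiv> (\<lambda>j n. - 1 / (N + 1) * partial n (theta a j) x
     - (\<Sum>\<alpha>\<in>UNIV. middle_connection a \<alpha> j n x * (- 1 / (N + 1) * theta a \<alpha> x))
     - (- 1 / (N + 1) * theta a j x) * (- 1 / (N + 1) * theta a n x))"
  shows "curv_at (\<lambda>i j k y. thomas a y i j k) i j m n x = curv_at (middle_connection a) i j m n x
     + delta i j * (P m n - P n m) + delta i m * P j n - delta i n * P j m"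
  unfolding curv_at_def
  by (rule curv_projective_change[OF middle_sym thomas_eq partial_thomas]) (simp add: P_def N_def)

end

section \<open>The invariants in terms of the Thomas object\<close>

text \<open>
  The invariants contain the bracket inside the sums over the repeated indices.  This lemma and the
  next one move it outside, so that \<^const>\<open>sigma_phi_deriv\<close> can be recognized.
\<close>

lemma sum_brack_collect:
  "(\<Sum>\<alpha>\<in>A. (brack (\<lambda>m n. d m * u \<alpha> n) m n - (\<Sum>\<beta>\<in>B. brack (\<lambda>m n. d m * s \<beta> * t \<beta> \<alpha> n) m n)
      + brack (\<lambda>m n. d m * v \<alpha> * w n) m n) * f \<alpha>)
   = d m * (\<Sum>\<alpha>\<in>A. (u \<alpha> n - (\<Sum>\<beta>\<in>B. s \<beta> * t \<beta> \<alpha> n) + v \<alpha> * w n) * f \<alpha>)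
     - d n * (\<Sum>\<alpha>\<in>A. (u \<alpha> m - (\<Sum>\<beta>\<in>B. s \<beta> * t \<beta> \<alpha> m) + v \<alpha> * w m) * f \<alpha>)"
proof -
  have "brack (\<lambda>m n. d m * u \<alpha> n) m n - (\<Sum>\<beta>\<in>B. brack (\<lambda>m n. d m * s \<beta> * t \<beta> \<alpha> n) m n)
      + brack (\<lambda>m n. d m * v \<alpha> * w n) m n
    = d m * (u \<alpha> n - (\<Sum>\<beta>\<in>B. s \<beta> * t \<beta> \<alpha> n) + v \<alpha> * w n)
      - d n * (u \<alpha> m - (\<Sum>\<beta>\<in>B. s \<beta> * t \<beta> \<alpha> m) + v \<alpha> * w m)" for \<alpha>
    by (simp add: brack_def sum_subtractf sum_distrib_left algebra_simps)
  then show ?thesis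
    by (simp add: left_diff_distrib sum_subtractf sum_distrib_left mult.assoc)
qed

lemma sum_brack_collect':
  "(\<Sum>\<alpha>\<in>A. (brack (\<lambda>m n. d m * u \<alpha> n) m n - (\<Sum>\<beta>\<in>B. brack (\<lambda>m n. d m * s \<beta> n) m n * t \<beta> \<alpha>)
      + brack (\<lambda>m n. d m * v \<alpha> n) m n * w \<alpha>) * f \<alpha>)
   = d m * (\<Sum>\<alpha>\<in>A. (u \<alpha> n - (\<Sum>\<beta>\<in>B. s \<beta> n * t \<beta> \<alpha>) + v \<alpha> n * w \<alpha>) * f \<alpha>)
     - d n * (\<Sum>\<alpha>\<in>A. (u \<alpha> m - (\<Sum>\<beta>\<in>B. s \<beta> m * t \<beta> \<alpha>) + v \<alpha> m * w \<alpha>) * f \<alpha>)"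
proof -
  have "brack (\<lambda>m n. d m * u \<alpha> n) m n - (\<Sum>\<beta>\<in>B. brack (\<lambda>m n. d m * s \<beta> n) m n * t \<beta> \<alpha>)
      + brack (\<lambda>m n. d m * v \<alpha> n) m n * w \<alpha>
    = d m * (u \<alpha> n - (\<Sum>\<beta>\<in>B. s \<beta> n * t \<beta> \<alpha>) + v \<alpha> n * w \<alpha>)
      - d n * (u \<alpha> m - (\<Sum>\<beta>\<in>B. s \<beta> m * t \<beta> \<alpha>) + v \<alpha> m * w \<alpha>)" for \<alpha>
    by (simp add: brack_def sum_subtractf sum_distrib_left algebra_simps)
  then show ?thesis
    by (simp add: left_diff_distrib sum_subtractf sum_distrib_left mult.assoc)
qed

text \<open>
  Since the second basic equation uses the full connection, the derivative in the associated space
  acquires a torsion term; it is the source of the torsion terms in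
  \<^const>\<open>assoc_inv\<close> and \<^const>\<open>weyl_inv\<close>.
\<close>

lemma cov_phi:
  assumes "torse_forming M a" "x \<in> M"
  shows "partial j (phi a i) x + (\<Sum>\<alpha>\<in>UNIV. symm (coeff a) i \<alpha> j x * phi a \<alpha> x)
    = nu a j x * phi a i x + mu a x * delta i j - (\<Sum>\<alpha>\<in>UNIV. tors (coeff a) i \<alpha> j x * phi a \<alpha> x)"
proof -
  have "partial j (phi a i) x + (\<Sum>\<alpha>\<in>UNIV. coeff a i \<alpha> j x * phi a \<alpha> x)
    = nu a j x * phi a i x + mu a x * delta i j"
    using assms by (simp add: torse_forming_def cov_first_kind_def)
  moreover have "(\<Sum>\<alpha>\<in>UNIV. coeff a i \<alpha> j x * phi a \<alpha> x)
    = (\<Sum>\<alpha>\<in>UNIV. symm (coeff a) i \<alpha> j x * phi a \<alpha> x) + (\<Sum>\<alpha>\<in>UNIV. tors (coeff a) i \<alpha> j x * phi a \<alpha> x)"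
    by (subst coeff_eq_symm_plus_tors) (simp add: distrib_right sum.distrib)
  ultimately show ?thesis by simp
qed

context
  fixes M :: "(real ^ 'n::finite) set" and a :: "'n space_data" and x :: "real ^ 'n"
  assumes M: "open M" and tf: "torse_forming M a" and x: "x \<in> M"
begin

private lemma adm: "admissible_data M a"
  using tf by (simp add: torse_forming_def)

text \<open>
  The effect of the deformation by \<open>\<sigma>\<^sub>j\<^sub>k \<phi>\<^sup>i\<close> with the derivatives of \<open>\<phi>\<close> eliminated.  These are the
  terms that the invariants add to the curvature tensor, apart from traces.
\<close>

lemma curv_at_middle:
  "curv_at (middle_connection a) i j m n x = curvature (coeff a) i j m n x
     + brack (\<lambda>m n. cov02 (coeff a) (sig a) j m n x) m n * phi a i x
     + (\<Sum>\<alpha>\<in>UNIV. brack (\<lambda>m n. sig a j m x * sig a \<alpha> n x) m n * phi a \<alpha> x * phi a i x)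
     - (\<Sum>\<alpha>\<in>UNIV. brack (\<lambda>m n. sig a j m x * tors (coeff a) i \<alpha> n x) m n * phi a \<alpha> x)
     + brack (\<lambda>m n. sig a j m x * nu a n x) m n * phi a i x
     - brack (\<lambda>m n. delta i m * mu a x * sig a j n x) m n"
proof -
  have *: "curv_at (middle_connection a) i j m n x = curv_at (symm (coeff a)) i j m n x
    + (cov02 (coeff a) (sig a) j m n x - cov02 (coeff a) (sig a) j n m x) * phi a i x
    + sig a j m x * (nu a n x * phi a i x + mu a x * delta i n - (\<Sum>\<alpha>\<in>UNIV. tors (coeff a) i \<alpha> n x * phi a \<alpha> x))
    - sig a j n x * (nu a m x * phi a i x + mu a x * delta i m - (\<Sum>\<alpha>\<in>UNIV. tors (coeff a) i \<alpha> m x * phi a \<alpha> x))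
    + (\<Sum>\<alpha>\<in>UNIV. (sig a j m x * sig a \<alpha> n x - sig a j n x * sig a \<alpha> m x) * phi a \<alpha> x * phi a i x)"
    unfolding curv_at_def
    by (rule curv_add_product[OF fun_cong[OF symm_commute], where ds = "\<lambda>j k l. partial l (sig a j k) x"
          and df = "\<lambda>i l. partial l (phi a i) x"])
      ((rule sig_sym[OF M adm x])?, simp_all add: middle_connection_def partial_middle[OF M adm x] cov02_def
        cov_phi[OF tf x])
  show ?thesis
    unfolding * curvature_eq_curv_at brack_def
    by (simp add: algebra_simps sum_subtractf sum_distrib_left)
qed

lemma cov_sigma_phi:
  "partial n (sigma_phi a j) x - (\<Sum>\<alpha>\<in>UNIV. symm (coeff a) \<alpha> j n x * sigma_phi a \<alpha> x)
   = sigma_phi_deriv a x j n + mu a x * sig a j n x"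
proof -
  have p: "partial n (phi a \<alpha>) x = nu a n x * phi a \<alpha> x + mu a x * delta \<alpha> n
     - (\<Sum>\<beta>\<in>UNIV. tors (coeff a) \<alpha> \<beta> n x * phi a \<beta> x) - (\<Sum>\<beta>\<in>UNIV. symm (coeff a) \<alpha> \<beta> n x * phi a \<beta> x)" for \<alpha>
    using cov_phi[OF tf x, of n \<alpha>] by linarith
  have swap: "(\<Sum>\<alpha>\<in>UNIV. \<Sum>\<beta>\<in>UNIV. sig a j \<alpha> x * (F \<alpha> \<beta> n x * phi a \<beta> x))
     = (\<Sum>\<alpha>\<in>UNIV. \<Sum>\<beta>\<in>UNIV. F \<beta> \<alpha> n x * (sig a j \<beta> x * phi a \<alpha> x))" for F :: "'n connection"
    by (subst sum.swap) (simp add: ac_simps)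
  have swap': "(\<Sum>\<alpha>\<in>UNIV. \<Sum>\<beta>\<in>UNIV. symm (coeff a) \<alpha> j n x * (sig a \<alpha> \<beta> x * phi a \<beta> x))
     = (\<Sum>\<alpha>\<in>UNIV. \<Sum>\<beta>\<in>UNIV. symm (coeff a) \<beta> j n x * (sig a \<beta> \<alpha> x * phi a \<alpha> x))"
    by (rule sum.swap)
  have d: "(\<Sum>\<alpha>\<in>UNIV. sig a j \<alpha> x * (mu a x * delta \<alpha> n)) = mu a x * sig a j n x"
    using sum_delta(4)[of "\<lambda>\<alpha>. sig a j \<alpha> x * mu a x" n] by (simp add: mult.assoc)
  show ?thesis
    unfolding partial_sigma_phi[OF M adm x] p
    by (simp add: cov02_def sigma_phi_def sigma_phi_deriv_def distrib_left distrib_right left_diff_distrib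
        right_diff_distrib sum.distrib sum_subtractf sum_distrib_left sum_distrib_right
        d swap swap') (simp add: ac_simps)
qed

text \<open>
  The terms with \<open>\<mu> \<sigma>\<close> and with the symmetric coefficients cancel by symmetry in \<open>m, n\<close>, so
  \<^const>\<open>sigma_phi_curl\<close> is the exterior derivative of \<^const>\<open>sigma_phi\<close> and depends on \<open>\<sigma>\<close> and
  \<open>\<phi>\<close> only through their product.
\<close>

lemma sigma_phi_curl_eq:
  "sigma_phi_curl a x m n = partial n (sigma_phi a m) x - partial m (sigma_phi a n) x"
proof -
  have "sigma_phi_curl a x m n = sigma_phi_deriv a x m n - sigma_phi_deriv a x n m"
    by (simp add: sigma_phi_curl_def sigma_phi_deriv_def Let_def brack_def algebra_simps
        sum_subtractf sum.distrib sum_distrib_left)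
  moreover have "(\<Sum>\<alpha>\<in>UNIV. symm (coeff a) \<alpha> m n x * sigma_phi a \<alpha> x)
      = (\<Sum>\<alpha>\<in>UNIV. symm (coeff a) \<alpha> n m x * sigma_phi a \<alpha> x)"
    by (simp add: symm_commute[of _ _ m n])
  ultimately show ?thesis
    using cov_sigma_phi[of n m] cov_sigma_phi[of m n]
    by (simp add: sig_sym[OF M adm x, of m n])
qed

text \<open>
  The derivative of \<open>\<theta>\<close> that enters the projective change from the middle connection to the Thomas
  object.  The last term comes from differentiating with respect to the middle connection instead of
  the associated one.
\<close>

lemma cov_theta:
  "partial n (theta a j) x - (\<Sum>\<alpha>\<in>UNIV. middle_connection a \<alpha> j n x * theta a \<alpha> x)
   = (\<Sum>\<alpha>\<in>UNIV. cov12 (coeff a) (symm (coeff a)) \<alpha> j \<alpha> n x) + sigma_phi_deriv a x j n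
     + mu a x * sig a j n x - sig a j n x * (\<Sum>\<alpha>\<in>UNIV. theta a \<alpha> x * phi a \<alpha> x)"
proof -
  let ?S = "\<lambda>i j k. symm (coeff a) i j k x"
  have "(\<Sum>\<alpha>\<in>UNIV. \<Sum>\<beta>\<in>UNIV. ?S \<alpha> \<beta> n * ?S \<beta> j \<alpha>) = (\<Sum>\<alpha>\<in>UNIV. \<Sum>\<beta>\<in>UNIV. ?S \<beta> \<alpha> n * ?S \<alpha> j \<beta>)"
    by (rule sum.swap)
  moreover have "(\<Sum>\<alpha>\<in>UNIV. \<Sum>\<beta>\<in>UNIV. ?S \<beta> j n * ?S \<alpha> \<beta> \<alpha>) = (\<Sum>\<alpha>\<in>UNIV. \<Sum>\<beta>\<in>UNIV. ?S \<alpha> j n * ?S \<beta> \<alpha> \<beta>)"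
    by (rule sum.swap)
  ultimately have c: "(\<Sum>\<alpha>\<in>UNIV. cov12 (coeff a) (symm (coeff a)) \<alpha> j \<alpha> n x)
     = (\<Sum>\<alpha>\<in>UNIV. partial n (symm (coeff a) \<alpha> j \<alpha>) x) - (\<Sum>\<alpha>\<in>UNIV. \<Sum>\<beta>\<in>UNIV. ?S \<alpha> j n * ?S \<beta> \<alpha> \<beta>)"
    by (simp add: cov12_def sum.distrib sum_subtractf)
  have m: "(\<Sum>\<alpha>\<in>UNIV. middle_connection a \<alpha> j n x * theta a \<alpha> x)
     = (\<Sum>\<alpha>\<in>UNIV. \<Sum>\<beta>\<in>UNIV. ?S \<alpha> j n * ?S \<beta> \<alpha> \<beta>) + (\<Sum>\<alpha>\<in>UNIV. ?S \<alpha> j n * sigma_phi a \<alpha> x)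
       + sig a j n x * (\<Sum>\<alpha>\<in>UNIV. theta a \<alpha> x * phi a \<alpha> x)"
  proof -
    have "(\<Sum>\<alpha>\<in>UNIV. middle_connection a \<alpha> j n x * theta a \<alpha> x)
      = (\<Sum>\<alpha>\<in>UNIV. ?S \<alpha> j n * theta a \<alpha> x) + sig a j n x * (\<Sum>\<alpha>\<in>UNIV. theta a \<alpha> x * phi a \<alpha> x)"
      by (simp add: middle_connection_def distrib_right distrib_left sum.distrib sum_distrib_left ac_simps)
    also have "(\<Sum>\<alpha>\<in>UNIV. ?S \<alpha> j n * theta a \<alpha> x)
      = (\<Sum>\<alpha>\<in>UNIV. \<Sum>\<beta>\<in>UNIV. ?S \<alpha> j n * ?S \<beta> \<alpha> \<beta>) + (\<Sum>\<alpha>\<in>UNIV. ?S \<alpha> j n * sigma_phi a \<alpha> x)"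
      by (simp add: theta_eq distrib_left sum.distrib sum_distrib_left)
    finally show ?thesis .
  qed
  show ?thesis
    unfolding c m partial_theta[OF M adm x]
    using cov_sigma_phi[of n j] by simp
qed

text \<open>
  The skew part of the Ricci tensor of a symmetric connection is the exterior derivative of the trace
  of the connection; this is how it can stand for derivatives of \<open>\<theta>\<close> in the invariants.
\<close>

lemma brack_ricci:
  "brack (\<lambda>i j. ricci (coeff a) i j x) m n
   = (\<Sum>\<alpha>\<in>UNIV. partial m (symm (coeff a) \<alpha> n \<alpha>) x) - (\<Sum>\<alpha>\<in>UNIV. partial n (symm (coeff a) \<alpha> m \<alpha>) x)"
proof -
  let ?S = "\<lambda>i j k. symm (coeff a) i j k x"
  have "(\<Sum>\<alpha>\<in>UNIV. \<Sum>\<beta>\<in>UNIV. ?S \<beta> m \<alpha> * ?S \<alpha> \<beta> n) = (\<Sum>\<alpha>\<in>UNIV. \<Sum>\<beta>\<in>UNIV. ?S \<beta> n \<alpha> * ?S \<alpha> \<beta> m)"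
    by (subst sum.swap) (simp add: symm_commute[of _ _ m] symm_commute[of _ _ n] mult.commute)
  then show ?thesis
    by (simp add: brack_def ricci_def curvature_def sum.distrib sum_subtractf symm_commute[of _ _ m n])
qed

text \<open>
  The basic associated invariant is the curvature formula applied to the Thomas object.  It follows
  from the curvature of the middle connection by the projective change with \<open>- \<theta> / (N + 1)\<close>.
\<close>

lemma assoc_inv_eq: "assoc_inv a x i j m n = curv_at (\<lambda>i j k y. thomas a y i j k) i j m n x"
proof -
  define N where "N = real CARD('n)"
  define P where "P = (\<lambda>j n. - 1 / (N + 1) * partial n (theta a j) x
     - (\<Sum>\<alpha>\<in>UNIV. middle_connection a \<alpha> j n x * (- 1 / (N + 1) * theta a \<alpha> x))
     - (- 1 / (N + 1) * theta a j x) * (- 1 / (N + 1) * theta a n x))"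
  define c where "c = (\<lambda>j n. \<Sum>\<alpha>\<in>UNIV. cov12 (coeff a) (symm (coeff a)) \<alpha> j \<alpha> n x)"
  define t where "t = (\<Sum>\<alpha>\<in>UNIV. theta a \<alpha> x * phi a \<alpha> x)"
  define M1 where "M1 = (\<lambda>j n. \<Sum>\<alpha>\<in>UNIV. middle_connection a \<alpha> j n x * theta a \<alpha> x)"
  have P': "P j n = - 1 / (N + 1) * (partial n (theta a j) x - M1 j n)
     - 1 / (N + 1)\<^sup>2 * theta a j x * theta a n x" for j n
    unfolding P_def M1_def
    by (simp add: sum_negf power2_eq_square diff_divide_distrib flip: sum_divide_distrib)
  have M1_sym: "M1 j n = M1 n j" for j n
    unfolding M1_def by (simp add: middle_sym[OF M adm x, of _ j n])
  have curl: "P m n - P n m = 1 / (N + 1) *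
      (brack (\<lambda>i j. ricci (coeff a) i j x) m n - sigma_phi_curl a x m n)"
    unfolding P' brack_ricci sigma_phi_curl_eq partial_theta[OF M adm x]
    by (simp add: M1_sym[of m n] algebra_simps add_divide_distrib diff_divide_distrib)
  have P'': "P j n = - 1 / (N + 1) * (c j n + sigma_phi_deriv a x j n + mu a x * sig a j n x)
      + 1 / (N + 1) * sig a j n x * t - 1 / (N + 1)\<^sup>2 * theta a j x * theta a n x" for j n
    unfolding P' M1_def cov_theta unfolding c_def t_def
    by (simp add: algebra_simps diff_divide_distrib add_divide_distrib)
  have Q: "(\<Sum>\<alpha>\<in>UNIV. (brack (\<lambda>m n. delta i m * cov02 (coeff a) (sig a) j \<alpha> n x) m n
        - (\<Sum>\<beta>\<in>UNIV. brack (\<lambda>m n. delta i m * sig a j \<beta> x * tors (coeff a) \<beta> \<alpha> n x) m n)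
        + brack (\<lambda>m n. delta i m * sig a j \<alpha> x * nu a n x) m n) * phi a \<alpha> x)
     = delta i m * sigma_phi_deriv a x j n - delta i n * sigma_phi_deriv a x j m"
    unfolding sigma_phi_deriv_def by (rule sum_brack_collect[where d = "delta i"])
  have T: "brack (\<lambda>m n. delta i m * (\<Sum>\<beta>\<in>UNIV. symm (coeff a) \<beta> n \<beta> x)) m n
        + (\<Sum>\<beta>\<in>UNIV. brack (\<lambda>m n. delta i m * sig a n \<beta> x) m n * phi a \<beta> x)
      = delta i m * theta a n x - delta i n * theta a m x"
    by (simp add: theta_def brack_def algebra_simps sum_subtractf sum_distrib_left)
  have "assoc_inv a x i j m n = curv_at (middle_connection a) i j m n x
     + delta i j * (P m n - P n m)
     - 1 / (N + 1) * (brack (\<lambda>m n. delta i m * c j n) m n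
        + (delta i m * sigma_phi_deriv a x j n - delta i n * sigma_phi_deriv a x j m)
        + brack (\<lambda>m n. delta i m * mu a x * sig a j n x) m n)
     + 1 / (N + 1) * brack (\<lambda>m n. delta i m * sig a j n x) m n * t
     - 1 / (N + 1)\<^sup>2 * theta a j x * (delta i m * theta a n x - delta i n * theta a m x)"
    unfolding assoc_inv_def Let_def Q T curv_at_middle curl N_def c_def t_def by simp
  also have "\<dots> = curv_at (middle_connection a) i j m n x
     + delta i j * (P m n - P n m) + delta i m * P j n - delta i n * P j m"
    unfolding P''[of j] brack_def
    by (simp add: algebra_simps diff_divide_distrib add_divide_distrib)
  also have "\<dots> = curv_at (\<lambda>i j k y. thomas a y i j k) i j m n x"
    unfolding P_def N_def by (rule curv_at_thomas[OF M adm x, symmetric])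
  finally show ?thesis .
qed

text \<open>
  The Ricci tensor of the middle connection consists of the Ricci tensor of the associated space, a
  symmetric part \<open>Y\<^sub>1 + Y\<^sub>2\<close>, for which the two coefficients of \<^const>\<open>weyl_of\<close> add up to
  \<open>1 / (N - 1)\<close>, the part \<open>- Q\<close> with \<open>Q\<close> the covariant derivative of \<^const>\<open>sigma_phi\<close> without
  \<open>\<mu>\<close>, and a multiple of \<open>\<mu> \<sigma>\<close> that cancels the \<open>\<mu>\<close>-term of the curvature.  The skew part of
  \<open>- Q\<close> is the source of the summand with \<^const>\<open>sigma_phi_curl\<close>.
\<close>

lemma weyl_inv_eq_middle:
  assumes "CARD('n) > 1"
  shows "weyl_inv a x i j m n = weyl_of (\<lambda>i j m n. curv_at (middle_connection a) i j m n x) i j m n"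
proof -
  define N where "N = real CARD('n)"
  have N: "N + 1 \<noteq> 0" "N\<^sup>2 - 1 = (N - 1) * (N + 1)" "N - 1 \<noteq> 0"
    using assms by (auto simp: N_def power2_eq_square algebra_simps)
  let ?\<sigma> = "\<lambda>j k. sig a j k x" and ?d\<sigma> = "\<lambda>j k l. cov02 (coeff a) (sig a) j k l x"
  let ?A = "\<lambda>i j k. tors (coeff a) i j k x" and ?\<phi> = "\<lambda>i. phi a i x" and ?\<nu> = "\<lambda>i. nu a i x"
  let ?Q = "sigma_phi_deriv a x"
  note sym = sig_sym[OF M adm x] cov02_sig_sym[OF M adm x]
  define Y1 where "Y1 = (\<lambda>j m. \<Sum>\<alpha>\<in>UNIV. (?d\<sigma> j m \<alpha> - (\<Sum>\<beta>\<in>UNIV. ?\<sigma> j m * ?A \<beta> \<alpha> \<beta>) + ?\<sigma> j m * ?\<nu> \<alpha>) * ?\<phi> \<alpha>)"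
  define Y2 where "Y2 = (\<lambda>j m. \<Sum>\<alpha>\<in>UNIV. \<Sum>\<beta>\<in>UNIV. (?\<sigma> j m * ?\<sigma> \<alpha> \<beta> - ?\<sigma> j \<alpha> * ?\<sigma> m \<beta>) * ?\<phi> \<alpha> * ?\<phi> \<beta>)"
  define B where "B = curv_at (middle_connection a) i j m n x - curvature (coeff a) i j m n x"
  have Y_sym: "Y1 j m = Y1 m j" "Y2 j m = Y2 m j" for j m
  proof -
    show "Y1 j m = Y1 m j"
      by (simp add: Y1_def sym(1)[of j m] sym(2)[of _ j m])
    show "Y2 j m = Y2 m j"
      unfolding Y2_def by (subst sum.swap) (simp add: sym(1) ac_simps)
  qed
  have Ric: "(\<Sum>\<alpha>\<in>UNIV. curv_at (middle_connection a) \<alpha> j m \<alpha> x)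
     = ricci (coeff a) j m x + Y1 j m + Y2 j m - ?Q j m + (N - 1) * mu a x * ?\<sigma> j m" for j m
  proof -
    have e1: "(\<Sum>\<alpha>\<in>UNIV. \<Sum>\<beta>\<in>UNIV. (?\<sigma> j m * ?\<sigma> \<beta> \<alpha> - ?\<sigma> j \<alpha> * ?\<sigma> \<beta> m) * ?\<phi> \<beta> * ?\<phi> \<alpha>) = Y2 j m"
      unfolding Y2_def by (simp add: sym(1) ac_simps)
    have e2: "(\<Sum>\<alpha>\<in>UNIV. \<Sum>\<beta>\<in>UNIV. (?\<sigma> j m * ?A \<alpha> \<beta> \<alpha> - ?\<sigma> j \<alpha> * ?A \<alpha> \<beta> m) * ?\<phi> \<beta>)
      = (\<Sum>\<alpha>\<in>UNIV. ((\<Sum>\<beta>\<in>UNIV. ?\<sigma> j m * ?A \<beta> \<alpha> \<beta>) - (\<Sum>\<beta>\<in>UNIV. ?\<sigma> j \<beta> * ?A \<beta> \<alpha> m)) * ?\<phi> \<alpha>)"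
      by (subst sum.swap) (simp add: sum_subtractf left_diff_distrib sum_distrib_right)
    have e3: "(\<Sum>\<alpha>\<in>UNIV. delta \<alpha> m * mu a x * ?\<sigma> j \<alpha> - delta \<alpha> \<alpha> * mu a x * ?\<sigma> j m)
      = - (N - 1) * mu a x * ?\<sigma> j m"
      by (simp add: sum_subtractf mult.assoc N_def algebra_simps)
    have "(\<Sum>\<alpha>\<in>UNIV. curv_at (middle_connection a) \<alpha> j m \<alpha> x) = ricci (coeff a) j m x
       + (\<Sum>\<alpha>\<in>UNIV. (?d\<sigma> j m \<alpha> - ?d\<sigma> j \<alpha> m) * ?\<phi> \<alpha>)
       + (\<Sum>\<alpha>\<in>UNIV. \<Sum>\<beta>\<in>UNIV. (?\<sigma> j m * ?\<sigma> \<beta> \<alpha> - ?\<sigma> j \<alpha> * ?\<sigma> \<beta> m) * ?\<phi> \<beta> * ?\<phi> \<alpha>)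
       - (\<Sum>\<alpha>\<in>UNIV. \<Sum>\<beta>\<in>UNIV. (?\<sigma> j m * ?A \<alpha> \<beta> \<alpha> - ?\<sigma> j \<alpha> * ?A \<alpha> \<beta> m) * ?\<phi> \<beta>)
       + (\<Sum>\<alpha>\<in>UNIV. (?\<sigma> j m * ?\<nu> \<alpha> - ?\<sigma> j \<alpha> * ?\<nu> m) * ?\<phi> \<alpha>)
       - (\<Sum>\<alpha>\<in>UNIV. delta \<alpha> m * mu a x * ?\<sigma> j \<alpha> - delta \<alpha> \<alpha> * mu a x * ?\<sigma> j m)"
      unfolding curv_at_middle brack_def ricci_def sum.distrib sum_subtractf by (rule refl)
    then show ?thesis
      unfolding e1 e2 e3 Y1_def sigma_phi_deriv_def
      by (simp add: algebra_simps sum.distrib sum_subtractf)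
  qed
  have Q_eq: "?Q j n = (\<Sum>\<alpha>\<in>UNIV. (?d\<sigma> \<alpha> j n - (\<Sum>\<beta>\<in>UNIV. ?\<sigma> \<beta> j * ?A \<beta> \<alpha> n) + ?\<sigma> \<alpha> j * ?\<nu> n) * ?\<phi> \<alpha>)" for j n
    by (simp add: sigma_phi_deriv_def sym(1)[of j] sym(2)[of _ j])
  have Y1: "(\<Sum>\<alpha>\<in>UNIV. (brack (\<lambda>m n. delta i m * ?d\<sigma> j n \<alpha>) m n
                - (\<Sum>\<beta>\<in>UNIV. brack (\<lambda>m n. delta i m * ?\<sigma> j n) m n * ?A \<beta> \<alpha> \<beta>)
                + brack (\<lambda>m n. delta i m * ?\<sigma> j n) m n * ?\<nu> \<alpha>) * ?\<phi> \<alpha>)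
     = delta i m * Y1 j n - delta i n * Y1 j m"
    unfolding Y1_def by (rule sum_brack_collect'[where d = "delta i"])
  have Y2: "(\<Sum>\<alpha>\<in>UNIV. \<Sum>\<beta>\<in>UNIV. (brack (\<lambda>m n. delta i m * ?\<sigma> j n) m n * ?\<sigma> \<alpha> \<beta>
                - brack (\<lambda>m n. delta i m * ?\<sigma> j \<alpha> * ?\<sigma> n \<beta>) m n) * ?\<phi> \<alpha> * ?\<phi> \<beta>)
     = delta i m * Y2 j n - delta i n * Y2 j m"
  proof -
    have "(brack (\<lambda>m n. delta i m * ?\<sigma> j n) m n * ?\<sigma> \<alpha> \<beta>
                - brack (\<lambda>m n. delta i m * ?\<sigma> j \<alpha> * ?\<sigma> n \<beta>) m n) * ?\<phi> \<alpha> * ?\<phi> \<beta>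
      = delta i m * ((?\<sigma> j n * ?\<sigma> \<alpha> \<beta> - ?\<sigma> j \<alpha> * ?\<sigma> n \<beta>) * ?\<phi> \<alpha> * ?\<phi> \<beta>)
        - delta i n * ((?\<sigma> j m * ?\<sigma> \<alpha> \<beta> - ?\<sigma> j \<alpha> * ?\<sigma> m \<beta>) * ?\<phi> \<alpha> * ?\<phi> \<beta>)" for \<alpha> \<beta>
      by (simp add: brack_def algebra_simps)
    then show ?thesis
      by (simp add: Y2_def sum_subtractf sum_distrib_left)
  qed
  have Q1: "(\<Sum>\<alpha>\<in>UNIV. (brack (\<lambda>m n. delta i m * ?d\<sigma> \<alpha> j n) m n
                - (\<Sum>\<beta>\<in>UNIV. brack (\<lambda>m n. delta i m * ?\<sigma> \<beta> j * ?A \<beta> \<alpha> n) m n)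
                + brack (\<lambda>m n. delta i m * ?\<sigma> \<alpha> j * ?\<nu> n) m n) * ?\<phi> \<alpha>)
     = delta i m * ?Q j n - delta i n * ?Q j m"
    unfolding Q_eq by (rule sum_brack_collect[where d = "delta i"])
  have Q2: "(\<Sum>\<alpha>\<in>UNIV. (brack (\<lambda>m n. delta i m * ?d\<sigma> \<alpha> n j) m n
                - (\<Sum>\<beta>\<in>UNIV. brack (\<lambda>m n. delta i m * ?\<sigma> \<beta> n) m n * ?A \<beta> \<alpha> j)
                + brack (\<lambda>m n. delta i m * ?\<sigma> \<alpha> n) m n * ?\<nu> j) * ?\<phi> \<alpha>)
     = delta i m * ?Q n j - delta i n * ?Q m j"
    unfolding Q_eq by (rule sum_brack_collect'[where d = "delta i"])
  have curl: "sigma_phi_curl a x m n = ?Q m n - ?Q n m"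
    by (simp add: sigma_phi_curl_def sigma_phi_deriv_def Let_def brack_def algebra_simps
        sum_subtractf sum.distrib sum_distrib_left)
  have "weyl_inv a x i j m n = curvature (coeff a) i j m n x
      + 1 / (N + 1) * delta i j * brack (\<lambda>i j. ricci (coeff a) i j x) m n
      + N / (N\<^sup>2 - 1) * brack (\<lambda>m n. delta i m * ricci (coeff a) j n x) m n
      + 1 / (N\<^sup>2 - 1) * brack (\<lambda>m n. delta i m * ricci (coeff a) n j x) m n
      + (B + brack (\<lambda>m n. delta i m * mu a x * ?\<sigma> j n) m n)
      + 1 / (N - 1) * (delta i m * Y1 j n - delta i n * Y1 j m)
      + 1 / (N - 1) * (delta i m * Y2 j n - delta i n * Y2 j m)
      - N / (N\<^sup>2 - 1) * (delta i m * ?Q j n - delta i n * ?Q j m)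
      - 1 / (N\<^sup>2 - 1) * (delta i m * ?Q n j - delta i n * ?Q m j)
      - 1 / (N + 1) * delta i j * (?Q m n - ?Q n m)"
    unfolding weyl_inv_def weyl_inv_printed_def Let_def Y1 Y2 Q1 Q2 curl B_def N_def curv_at_middle
    by simp
  also have "\<dots> = weyl_of (\<lambda>i j m n. curv_at (middle_connection a) i j m n x) i j m n"
    unfolding weyl_of_def Let_def brack_def Ric
    unfolding N_def[symmetric] N(2) Y_sym[of n m] Y_sym[of n j] Y_sym[of m j] B_def
      sym(1)[of n j] sym(1)[of m j] sym(1)[of n m]
    using N(1,3) by (simp add: divide_simps) algebra
  finally show ?thesis .
qed

text \<open>
  The middle connection and the Thomas object are projectively related, hence have the same Weyl
  tensor.
\<close>

lemma weyl_inv_eq: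
  assumes "CARD('n) > 1"
  shows "weyl_inv a x i j m n
    = weyl_of (\<lambda>i j m n. curv_at (\<lambda>i j k y. thomas a y i j k) i j m n x) i j m n"
  unfolding weyl_inv_eq_middle[OF assms]
  by (rule weyl_of_projective_change[OF assms curv_at_thomas[OF M adm x], symmetric])

end

section \<open>Objects determined by the Thomas object and the torsion\<close>

text \<open>
  The first-order data that an equitorsion mapping preserves.
\<close>

definition thomas_jet where
  "thomas_jet (a :: ('n::finite) space_data) x =
     (thomas a x, (\<lambda>i j k l. partial l (\<lambda>y. thomas a y i j k) x),
      (\<lambda>i j k. tors (coeff a) i j k x), (\<lambda>i j k l. partial l (tors (coeff a) i j k) x))"

text \<open>
  The jet does not contain \<open>\<nu>\<close> and \<open>\<mu>\<close>: they enter the invariants in combinations that the second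
  basic equation expresses by derivatives of \<open>\<phi>\<close>.
\<close>

definition thomas_determined :: "(('n::finite) space_data \<Rightarrow> real ^ 'n \<Rightarrow> 'c) \<Rightarrow> bool" where
  "thomas_determined U \<longleftrightarrow> (\<forall>M a x M' a' x'.
     open M \<and> torse_forming M a \<and> x \<in> M \<and> open M' \<and> torse_forming M' a' \<and> x' \<in> M'
     \<and> thomas_jet a x = thomas_jet a' x' \<longrightarrow> U a x = U a' x')"

lemma thomas_determined_assoc_inv:
  "thomas_determined (assoc_inv :: ('n::finite) space_data \<Rightarrow> _)"
proof -
  have "assoc_inv a x = curv (thomas a x) (\<lambda>i j k l. partial l (\<lambda>y. thomas a y i j k) x)"
    if "open M" "torse_forming M a" "x \<in> M" for M and a :: "'n space_data" and x
    using assoc_inv_eq[OF that] by (intro ext) (simp add: curv_at_def)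
  then show ?thesis
    unfolding thomas_determined_def thomas_jet_def by (metis (no_types, lifting) prod.inject)
qed

lemma thomas_determined_weyl_inv:
  assumes "CARD('n::finite) > 1"
  shows "thomas_determined (weyl_inv :: 'n space_data \<Rightarrow> _)"
proof -
  have "weyl_inv a x = weyl_of (assoc_inv a x)"
    if "open M" "torse_forming M a" "x \<in> M" for M and a :: "'n space_data" and x
  proof -
    have "assoc_inv a x = (\<lambda>i j m n. curv_at (\<lambda>i j k y. thomas a y i j k) i j m n x)"
      by (intro ext assoc_inv_eq[OF that])
    then show ?thesis
      by (intro ext) (simp add: weyl_inv_eq[OF that assms])
  qed
  then show ?thesis
    using thomas_determined_assoc_inv unfolding thomas_determined_def by metis
qed

lemma symm_eq_omega_sel:
  "symm (coeff a) i j k x = omega_sel p a x i j k + (if p = 1 then 0 else thomas a x i j k)"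
  by (simp add: omega_sel_def omega_def thomas_def Let_def)

text \<open>
  Subtracting \<open>\<omega>\<close> replaces a coefficient of the associated connection by a component of the Thomas
  object for the choice \<open>2\<close> and by \<open>0\<close> for the choice \<open>1\<close>.  In both cases what is left of the
  covariant derivative of the torsion is determined by invariant quantities.
\<close>

lemma cov12_tors_minus_omega:
  fixes a :: "('n::finite) space_data" and x A T
  defines "A \<equiv> (\<lambda>i j k. tors (coeff a) i j k x)"
  defines "T \<equiv> (\<lambda>p i j k. if p = (1::nat) then 0 else thomas a x i j k)"
  shows "cov12 (coeff a) (tors (coeff a)) i j m n x
      - ((\<Sum>\<alpha>\<in>UNIV. omega_sel p1 a x i \<alpha> n * A \<alpha> j m)
        - (\<Sum>\<alpha>\<in>UNIV. omega_sel p2 a x \<alpha> j n * A i \<alpha> m)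
        - (\<Sum>\<alpha>\<in>UNIV. omega_sel p3 a x \<alpha> m n * A i j \<alpha>))
    = partial n (tors (coeff a) i j m) x
      + (\<Sum>\<alpha>\<in>UNIV. T p1 i \<alpha> n * A \<alpha> j m) - (\<Sum>\<alpha>\<in>UNIV. T p2 \<alpha> j n * A i \<alpha> m)
      - (\<Sum>\<alpha>\<in>UNIV. T p3 \<alpha> m n * A i j \<alpha>)"
proof -
  have split: "(\<Sum>\<alpha>\<in>UNIV. symm (coeff a) (f \<alpha>) (g \<alpha>) k x * h \<alpha>)
     = (\<Sum>\<alpha>\<in>UNIV. omega_sel p a x (f \<alpha>) (g \<alpha>) k * h \<alpha>) + (\<Sum>\<alpha>\<in>UNIV. T p (f \<alpha>) (g \<alpha>) k * h \<alpha>)"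
    for f g k p and h :: "_ \<Rightarrow> real"
    unfolding symm_eq_omega_sel[of a _ _ _ x p] T_def by (simp only: distrib_right sum.distrib)
  show ?thesis
    unfolding cov12_def A_def
    using split[of "\<lambda>_. i" "\<lambda>\<alpha>. \<alpha>" n "\<lambda>\<alpha>. tors (coeff a) \<alpha> j m x" p1]
      split[of "\<lambda>\<alpha>. \<alpha>" "\<lambda>_. j" n "\<lambda>\<alpha>. tors (coeff a) i \<alpha> m x" p2]
      split[of "\<lambda>\<alpha>. \<alpha>" "\<lambda>_. m" n "\<lambda>\<alpha>. tors (coeff a) i j \<alpha> x" p3]
    by simp
qed

lemma omega_sel_sym:
  assumes "admissible_data M a" "x \<in> M"
  shows "omega_sel p a x i j k = omega_sel p a x i k j"
  using assms by (simp add: omega_sel_def omega_def Let_def symm_commute[of _ i j k] admissible_data_def)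

text \<open>
  The two summands of the torsion part are the same expression with \<open>m\<close> and \<open>n\<close> interchanged, except
  for the last \<open>\<omega>\<close>, which is symmetric.
\<close>

lemma thomas_determined_torsion_part:
  "thomas_determined (torsion_part u u' p q :: ('n::finite) space_data \<Rightarrow> _)"
proof -
  obtain p1 p2 p3 q1 q2 q3 where pq: "p = (p1, p2, p3)" "q = (q1, q2, q3)"
    by (metis prod_cases3)
  define T where "T = (\<lambda>p a x i j k. if p = (1::nat) then 0 else thomas a x i j (k::'n))"
  define H where "H = (\<lambda>p1 p2 p3 a x i j m n. partial n (tors (coeff a) i j m) x
      + (\<Sum>\<alpha>\<in>UNIV. T p1 a x i \<alpha> n * tors (coeff a) \<alpha> j m x)
      - (\<Sum>\<alpha>\<in>UNIV. T p2 a x \<alpha> j n * tors (coeff a) i \<alpha> m x)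
      - (\<Sum>\<alpha>\<in>UNIV. T p3 a x \<alpha> m n * tors (coeff a) i j \<alpha> x))"
  have eq: "torsion_part u u' p q a x i j m n = u * H p1 p2 p3 a x i j m n + u' * H q1 q2 q3 a x i j n m"
    if "admissible_data M a" "x \<in> M" for M and a :: "'n space_data" and x i j m n
    unfolding H_def T_def cov12_tors_minus_omega[symmetric] torsion_part_def Let_def pq
    by (simp add: right_diff_distrib omega_sel_sym[OF that, of _ _ n m])
  have "torsion_part u u' p q a x = torsion_part u u' p q a' x'"
    if "admissible_data M a" "x \<in> M" "admissible_data M' a'" "x' \<in> M'" "thomas_jet a x = thomas_jet a' x'"
    for M M' and a a' :: "'n space_data" and x x'
  proof -
    have "thomas a x = thomas a' x'" "tors (coeff a) i j k x = tors (coeff a') i j k x'"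
      "partial l (tors (coeff a) i j k) x = partial l (tors (coeff a') i j k) x'" for i j k l
      using that(5) by (simp_all add: thomas_jet_def fun_eq_iff)
    moreover from this(1) have "T r a x = T r a' x'" for r
      by (intro ext) (simp add: T_def)
    ultimately show ?thesis
      by (intro ext) (simp add: eq[OF that(1,2)] eq[OF that(3,4)] H_def)
  qed
  then show ?thesis
    unfolding thomas_determined_def torse_forming_def by blast
qed

lemma thomas_determined_with_torsion:
  assumes "thomas_determined W"
  shows "thomas_determined (with_torsion W u u' p q)"
  using assms thomas_determined_torsion_part[of u u' p q]
  unfolding thomas_determined_def with_torsion_def fun_eq_iff by metis

section \<open>Behaviour under the mapping\<close>

text \<open>
  Because \<open>\<sigma> \<otimes> \<phi>\<close> changes sign, the middle connection changes only by \<open>\<psi>\<^sub>j \<delta>\<^sup>i\<^sub>k + \<psi>\<^sub>k \<delta>\<^sup>i\<^sub>j\<close>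
  and its trace \<open>\<theta>\<close> by \<open>(N + 1) \<psi>\<close>, which the Thomas object is built to absorb.
\<close>

lemma
  fixes M :: "(real ^ 'n::finite) set"
  assumes "equitorsion_pi3_mapping M \<psi> a Lbar" "corresponding_data M a Lbar b" "y \<in> M"
  shows corresponding_sigma_phi: "sigma_phi b j y = - sigma_phi a j y"
    and corresponding_thomas: "thomas b y = thomas a y"
    and corresponding_tors: "tors (coeff b) i j k y = tors (coeff a) i j k y"
proof -
  have L: "coeff b = Lbar" and "2 * sig b j k y * phi b i y = - (2 * sig a j k y * phi a i y)" for i j k
    using assms(2,3) unfolding corresponding_data_def by blast+
  then have s: "sig b j k y * phi b i y = - (sig a j k y * phi a i y)" for i j k
    by (metis minus_mult_right mult.assoc mult_left_cancel zero_neq_numeral)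
  have S: "symm Lbar i j k y = symm (coeff a) i j k y + \<psi> j y * delta i k + \<psi> k y * delta i j
      + 2 * (sig a j k y * phi a i y)" for i j k
    using assms(1,3) by (simp add: equitorsion_pi3_mapping_def pi3_mapping_def)
  show sp: "sigma_phi b j y = - sigma_phi a j y" for j
    by (simp add: sigma_phi_def s sum_negf)
  have middle: "middle_connection b i j k y = middle_connection a i j k y + \<psi> j y * delta i k + \<psi> k y * delta i j" for i j k
    by (simp add: middle_connection_def L S s)
  have theta: "theta b j y = theta a j y + (real CARD('n) + 1) * \<psi> j y" for j
    unfolding theta_eq sp L S
    by (simp add: sum.distrib sum_distrib_left[symmetric] sigma_phi_def algebra_simps)
  have "- 1 / (real CARD('n) + 1) * theta b j y = - 1 / (real CARD('n) + 1) * theta a j y - \<psi> j y" for j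
    unfolding theta by (simp add: field_simps add_nonneg_eq_0_iff)
  then show "thomas b y = thomas a y"
    unfolding fun_eq_iff thomas_eq middle by (simp only:) (simp add: algebra_simps)
  show "tors (coeff b) i j k y = tors (coeff a) i j k y"
    using assms(1,3) by (simp add: L equitorsion_pi3_mapping_def equitorsion_def)
qed

lemma corresponding_thomas_jet:
  assumes "open M" "equitorsion_pi3_mapping M \<psi> a Lbar" "corresponding_data M a Lbar b" "x \<in> M"
  shows "thomas_jet b x = thomas_jet a x"
proof -
  have "partial l (\<lambda>y. thomas b y i j k) x = partial l (\<lambda>y. thomas a y i j k) x" for i j k l
    by (rule partial_cong_open[OF assms(1,4)]) (simp add: corresponding_thomas[OF assms(2,3)])
  moreover have "partial l (tors (coeff b) i j k) x = partial l (tors (coeff a) i j k) x" for i j k l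
    by (rule partial_cong_open[OF assms(1,4)]) (simp add: corresponding_tors[OF assms(2,3)])
  ultimately show ?thesis
    by (simp add: thomas_jet_def corresponding_thomas[OF assms(2-4)] corresponding_tors[OF assms(2-4)])
qed

lemma equitorsion_pi3_mapping_imp_torse_forming:
  "equitorsion_pi3_mapping M \<psi> a Lbar \<Longrightarrow> torse_forming M a"
  by (simp add: equitorsion_pi3_mapping_def pi3_mapping_def torse_forming_def)

lemma corresponding_partial_sigma_phi:
  assumes "open M" "equitorsion_pi3_mapping M \<psi> a Lbar" "corresponding_data M a Lbar b" "x \<in> M"
  shows "partial l (sigma_phi b j) x = - partial l (sigma_phi a j) x"
proof -
  have adm: "admissible_data M a"
    using equitorsion_pi3_mapping_imp_torse_forming[OF assms(2)] by (simp add: torse_forming_def)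
  have "partial l (sigma_phi b j) x = partial l (\<lambda>y. - 1 * sigma_phi a j y) x"
    by (rule partial_cong_open[OF assms(1,4)]) (simp add: corresponding_sigma_phi[OF assms(2,3)])
  also have "\<dots> = - 1 * partial l (sigma_phi a j) x"
    by (rule partial_cmult[OF differentiable_sigma_phi[OF assms(1) adm assms(4)]])
  finally show ?thesis by simp
qed

text \<open>
  By smoothness, the partial derivatives of sums and products can be computed from those of the
  connection coefficients, \<open>\<sigma>\<close> and \<open>\<phi>\<close>.\<close>

lemma
  assumes "open M" "admissible_data M b" "x \<in> M" "open M'" "admissible_data M' b'" "x' \<in> M'"
    and "jet b x = jet b' x'"
  shows jet_determines_thomas_jet: "thomas_jet b x = thomas_jet b' x'"
    and jet_determines_partial_sigma_phi: "partial l (sigma_phi b j) x = partial l (sigma_phi b' j) x'"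
proof -
  note b = assms(1-3) and b' = assms(4-6)
  have j: "coeff b i j k x = coeff b' i j k x'" "partial l (coeff b i j k) x = partial l (coeff b' i j k) x'"
    "sig b j k x = sig b' j k x'" "partial l (sig b j k) x = partial l (sig b' j k) x'"
    "phi b i x = phi b' i x'" "partial l (phi b i) x = partial l (phi b' i) x'" for i j k l
    using assms(7) by (simp_all add: jet_def fun_eq_iff)
  have s: "symm (coeff b) i j k x = symm (coeff b') i j k x'"
    "tors (coeff b) i j k x = tors (coeff b') i j k x'"
    "partial l (symm (coeff b) i j k) x = partial l (symm (coeff b') i j k) x'"
    "partial l (tors (coeff b) i j k) x = partial l (tors (coeff b') i j k) x'" for i j k l
    by (simp_all add: symm_def tors_def j partial_symm[OF b] partial_symm[OF b']
        partial_tors[OF b] partial_tors[OF b'])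
  show ds: "partial l (sigma_phi b j) x = partial l (sigma_phi b' j) x'" for l j
    by (simp add: partial_sigma_phi[OF b] partial_sigma_phi[OF b'] j)
  have "theta b j x = theta b' j x'" "partial l (theta b j) x = partial l (theta b' j) x'" for j l
    by (simp_all add: theta_def partial_theta[OF b] partial_theta[OF b'] s j ds)
  moreover from this have "partial l (\<lambda>y. thomas b y i j k) x = partial l (\<lambda>y. thomas b' y i j k) x'"
    for i j k l
    by (simp only: s j partial_thomas[OF b] partial_thomas[OF b'] partial_middle[OF b] partial_middle[OF b'])
  moreover have "thomas b x = thomas b' x'"
    by (intro ext) (simp add: thomas_eq middle_connection_def s j calculation)
  ultimately show "thomas_jet b x = thomas_jet b' x'"
    by (simp add: thomas_jet_def s)
qed

text \<open>
  A form \<open>V\<close> valid for all mappings exists as soon as the value of \<open>U\<close> is the same for any two mappings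
  whose target data have the same jet; \<open>V\<close> is then obtained by choice.
\<close>

lemma valued_invarianceI:
  fixes U :: "('n::finite) space_data \<Rightarrow> real ^ 'n \<Rightarrow> 'c"
  assumes "\<And>M \<psi> a Lbar b x M' \<psi>' a' Lbar' b' x'.
    \<lbrakk>open M; equitorsion_pi3_mapping M \<psi> a Lbar; corresponding_data M a Lbar b; x \<in> M;
     open M'; equitorsion_pi3_mapping M' \<psi>' a' Lbar'; corresponding_data M' a' Lbar' b'; x' \<in> M';
     jet b x = jet b' x'\<rbrakk> \<Longrightarrow> U a x = U a' x'"
  shows "valued_invariance U"
proof -
  define Q where "Q = (\<lambda>J v. \<exists>M \<psi> a Lbar b x. open M \<and> equitorsion_pi3_mapping M \<psi> a Lbar
    \<and> corresponding_data M a Lbar b \<and> x \<in> M \<and> jet b x = J \<and> U a x = v)"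
  have uniq: "v = w" if "Q J v" "Q J w" for J v w
  proof -
    from that(1) obtain M \<psi> a Lbar b x where 1: "open M" "equitorsion_pi3_mapping M \<psi> a Lbar"
      "corresponding_data M a Lbar b" "x \<in> M" "jet b x = J" "U a x = v"
      unfolding Q_def by blast
    from that(2) obtain M' \<psi>' a' Lbar' b' x' where 2: "open M'" "equitorsion_pi3_mapping M' \<psi>' a' Lbar'"
      "corresponding_data M' a' Lbar' b'" "x' \<in> M'" "jet b' x' = J" "U a' x' = w"
      unfolding Q_def by blast
    show ?thesis
      using assms[OF 1(1-4) 2(1-4)] 1(5,6) 2(5,6) by simp
  qed
  have "U a x = (SOME v. Q (jet b x) v)"
    if "open M" "equitorsion_pi3_mapping M \<psi> a Lbar" "corresponding_data M a Lbar b" "x \<in> M"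
    for M \<psi> a Lbar b x
  proof -
    have "Q (jet b x) (U a x)"
      unfolding Q_def using that by blast
    then show ?thesis
      using uniq by (metis someI)
  qed
  then show ?thesis
    unfolding valued_invariance_def by (intro exI[of _ "\<lambda>J. SOME v. Q J v"]) blast
qed

text \<open>
  The constant \<open>c\<close> covers both kinds of objects: those determined by the Thomas object and the torsion
  (\<open>c = 0\<close>), and those that lack the curl summand (\<open>c = 1 / (N + 1)\<close>).  The curl of the source space is
  the negative of the one computed from the target data.
\<close>

lemma valued_invariance_add_curl:
  fixes U :: "('n::finite) space_data \<Rightarrow> real ^ 'n \<Rightarrow> 'n \<Rightarrow> 'n \<Rightarrow> 'n \<Rightarrow> 'n \<Rightarrow> real"
  assumes W: "thomas_determined W"
    and U: "\<And>a x i j m n. U a x i j m n = W a x i j m n + c * delta i j * sigma_phi_curl a x m n"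
  shows "valued_invariance U"
proof (rule valued_invarianceI)
  fix M \<psi> a Lbar b x M' \<psi>' a' Lbar' b' x'
  assume 1: "open M" "equitorsion_pi3_mapping M \<psi> a Lbar" "corresponding_data M a Lbar b" "x \<in> M"
    and 2: "open M'" "equitorsion_pi3_mapping M' \<psi>' a' Lbar'" "corresponding_data M' a' Lbar' b'" "x' \<in> M'"
    and jet: "jet (b :: 'n space_data) x = jet b' x'"
  note tf = equitorsion_pi3_mapping_imp_torse_forming[OF 1(2)]
    and tf' = equitorsion_pi3_mapping_imp_torse_forming[OF 2(2)]
  have adm: "admissible_data M b" "admissible_data M' b'"
    using 1(3) 2(3) unfolding corresponding_data_def by blast+
  note jet_det = 1(1) adm(1) 1(4) 2(1) adm(2) 2(4) jet
  have "thomas_jet a x = thomas_jet a' x'"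
    using jet_determines_thomas_jet[OF jet_det] corresponding_thomas_jet[OF 1] corresponding_thomas_jet[OF 2]
    by simp
  then have "W a x = W a' x'"
    using W 1 2 tf tf' unfolding thomas_determined_def by blast
  moreover have "partial l (sigma_phi a j) x = partial l (sigma_phi a' j) x'" for l j
    using jet_determines_partial_sigma_phi[OF jet_det, of l j]
      corresponding_partial_sigma_phi[OF 1] corresponding_partial_sigma_phi[OF 2] by simp
  ultimately show "U a x = U a' x'"
    by (intro ext) (simp add: U sigma_phi_curl_eq[OF 1(1) tf 1(4)] sigma_phi_curl_eq[OF 2(1) tf' 2(4)])
qed

text \<open>
  For an equitorsion mapping the vector field \<open>\<phi>\<close> is torse-forming in the target space, too.  The two
  connections differ by \<open>\<psi>\<^sub>j \<delta>\<^sup>i\<^sub>k + \<psi>\<^sub>k \<delta>\<^sup>i\<^sub>j + 2 \<sigma>\<^sub>j\<^sub>k \<phi>\<^sup>i\<close> exactly, and contracting this with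
  \<open>\<phi>\<close> in \<open>j\<close> gives a multiple of \<open>\<delta>\<^sup>i\<^sub>k\<close>, which is added to \<open>\<mu>\<close>, and a multiple of \<open>\<phi>\<^sup>i\<close>, whose
  coefficient is added to \<open>\<nu>\<close>.  Hence \<open>- \<sigma>\<close>, \<open>\<phi>\<close> and the new \<open>\<nu>, \<mu>\<close> are data of the inverse mapping.
\<close>

lemma ex_inverse_data:
  fixes M :: "(real ^ 'n::finite) set"
  assumes "open M" "equitorsion_pi3_mapping M \<psi> a Lbar"
  obtains b where "inverse_data M a Lbar b"
proof -
  define b where "b = \<lparr>coeff = Lbar, sig = (\<lambda>j k x. - sig a j k x), phi = phi a,
    nu = (\<lambda>j x. nu a j x + \<psi> j x + 2 * (\<Sum>\<alpha>\<in>UNIV. sig a \<alpha> j x * phi a \<alpha> x)),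
    mu = (\<lambda>x. mu a x + (\<Sum>\<alpha>\<in>UNIV. \<psi> \<alpha> x * phi a \<alpha> x))\<rparr>"
  have b: "coeff b = Lbar" "\<And>j k x. sig b j k x = - sig a j k x" "phi b = phi a"
    "\<And>j x. nu b j x = nu a j x + \<psi> j x + 2 * (\<Sum>\<alpha>\<in>UNIV. sig a \<alpha> j x * phi a \<alpha> x)"
    "\<And>x. mu b x = mu a x + (\<Sum>\<alpha>\<in>UNIV. \<psi> \<alpha> x * phi a \<alpha> x)"
    by (simp_all add: b_def)
  from assms(2) have adm: "admissible_data M a" and Lbar: "nonsymmetric_space M Lbar"
    and \<psi>: "\<And>j. smooth M (\<psi> j)"
    and S: "\<And>x i j k. x \<in> M \<Longrightarrow> symm Lbar i j k x
      = symm (coeff a) i j k x + \<psi> j x * delta i k + \<psi> k x * delta i j + 2 * sig a j k x * phi a i x"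
    and \<phi>: "\<And>x i j. x \<in> M \<Longrightarrow>
      cov_first_kind (coeff a) (phi a) i j x = nu a j x * phi a i x + mu a x * delta i j"
    and A: "\<And>x i j k. x \<in> M \<Longrightarrow> tors Lbar i j k x = tors (coeff a) i j k x"
    by (simp_all add: equitorsion_pi3_mapping_def pi3_mapping_def equitorsion_def)
  have sm: "smooth M (sig a j k)" "smooth M (phi a i)" "smooth M (nu a j)" "smooth M (mu a)" for i j k
    using adm by (simp_all add: admissible_data_def)
  have adm_b: "admissible_data M b"
    unfolding admissible_data_def
  proof (intro conjI allI ballI)
    show "nonsymmetric_space M (coeff b)" by (simp add: b Lbar)
    show "smooth M (sig b j k)" for j k
      by (simp add: b_def smooth_uminus assms(1) sm)
    show "sig b j k x = sig b k j x" if "x \<in> M" for j k x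
      using adm that by (simp add: b admissible_data_def)
    show "smooth M (phi b i)" for i by (simp add: b sm)
    show "smooth M (nu b j)" for j
      by (simp add: b_def smooth_add smooth_mult smooth_sum smooth_const assms(1) sm \<psi>)
    show "smooth M (mu b)"
      by (simp add: b_def smooth_add smooth_mult smooth_sum assms(1) sm \<psi>)
  qed
  have "cov_first_kind (coeff b) (phi b) i j x = nu b j x * phi b i x + mu b x * delta i j"
    if x: "x \<in> M" for x i j
  proof -
    have "Lbar i \<alpha> j x * phi a \<alpha> x = coeff a i \<alpha> j x * phi a \<alpha> x + \<psi> \<alpha> x * phi a \<alpha> x * delta i j
        + \<psi> j x * phi a \<alpha> x * delta i \<alpha> + 2 * (sig a \<alpha> j x * phi a \<alpha> x) * phi a i x" for \<alpha>
      using coeff_eq_symm_plus_tors[of Lbar i \<alpha> j x] coeff_eq_symm_plus_tors[of "coeff a" i \<alpha> j x]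
      by (simp add: S[OF x] A[OF x] algebra_simps)
    then have "(\<Sum>\<alpha>\<in>UNIV. Lbar i \<alpha> j x * phi a \<alpha> x) = (\<Sum>\<alpha>\<in>UNIV. coeff a i \<alpha> j x * phi a \<alpha> x)
        + (\<Sum>\<alpha>\<in>UNIV. \<psi> \<alpha> x * phi a \<alpha> x) * delta i j + \<psi> j x * phi a i x
        + 2 * (\<Sum>\<alpha>\<in>UNIV. sig a \<alpha> j x * phi a \<alpha> x) * phi a i x"
      by (simp add: sum.distrib sum_distrib_left sum_distrib_right)
    with \<phi>[OF x, of i j] show ?thesis
      by (simp add: b cov_first_kind_def algebra_simps)
  qed
  then have "pi3_mapping M (\<lambda>j x. - \<psi> j x) b (coeff a)"
    using adm adm_b S by (simp add: pi3_mapping_def b smooth_uminus assms(1) \<psi> admissible_data_def)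
  then have "inverse_data M a Lbar b"
    unfolding inverse_data_def corresponding_data_def using adm_b by (auto simp: b)
  then show thesis ..
qed

lemma reciprocity_equitorsion:
  assumes "open M" "equitorsion_pi3_mapping M \<psi> a Lbar"
  shows "reciprocity M a Lbar"
proof -
  obtain b where "inverse_data M a Lbar b"
    using ex_inverse_data[OF assms] .
  then show ?thesis
    unfolding reciprocity_def inverse_data_def corresponding_data_def by blast
qed

text \<open>
  The curl changes sign under the mapping, so the object changes by \<open>- 2 c \<delta>\<^sup>i\<^sub>j\<close> times the curl.
\<close>

lemma total_invariance_add_curl:
  fixes U :: "('n::finite) space_data \<Rightarrow> real ^ 'n \<Rightarrow> 'n \<Rightarrow> 'n \<Rightarrow> 'n \<Rightarrow> 'n \<Rightarrow> real"
  assumes M: "open M" and f: "equitorsion_pi3_mapping M \<psi> a Lbar"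
    and W: "thomas_determined W"
    and U: "\<And>a x i j m n. U a x i j m n = W a x i j m n + c * delta i j * sigma_phi_curl a x m n"
  shows "total_invariance inverse_data M a Lbar U
    \<longleftrightarrow> c = 0 \<or> (\<forall>x\<in>M. \<forall>m n. sigma_phi_curl a x m n = 0)"
proof -
  note tf = equitorsion_pi3_mapping_imp_torse_forming[OF f]
  have diff: "U b x i j m n = U a x i j m n - 2 * c * delta i j * sigma_phi_curl a x m n"
    if b: "inverse_data M a Lbar b" and x: "x \<in> M" for b x i j m n
  proof -
    have tf_b: "torse_forming M b" and corr: "corresponding_data M a Lbar b"
      using b by (auto simp: inverse_data_def pi3_mapping_def torse_forming_def)
    have "W b x = W a x"
      using W M x tf tf_b corresponding_thomas_jet[OF M f corr x] unfolding thomas_determined_def by blast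
    moreover have "sigma_phi_curl b x m n = - sigma_phi_curl a x m n"
      by (simp add: sigma_phi_curl_eq[OF M tf x] sigma_phi_curl_eq[OF M tf_b x]
          corresponding_partial_sigma_phi[OF M f corr x])
    ultimately show ?thesis by (simp add: U)
  qed
  obtain b where b: "inverse_data M a Lbar b"
    using ex_inverse_data[OF M f] .
  show ?thesis
  proof
    assume "total_invariance inverse_data M a Lbar U"
    then have "c * sigma_phi_curl a x m n = 0" if "x \<in> M" for x m n
      \<comment> \<open>the component with equal first two indices, where the Kronecker symbol is \<open>1\<close>\<close>
      using diff[OF b that, of m m m n] b that by (simp add: total_invariance_def)
    then show "c = 0 \<or> (\<forall>x\<in>M. \<forall>m n. sigma_phi_curl a x m n = 0)"
      by auto
  next
    assume "c = 0 \<or> (\<forall>x\<in>M. \<forall>m n. sigma_phi_curl a x m n = 0)"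
    then have "U b x = U a x" if "inverse_data M a Lbar b" "x \<in> M" for b x
      using diff[OF that] that(2) by (intro ext) auto
    then show "total_invariance inverse_data M a Lbar U"
      unfolding total_invariance_def using b by blast
  qed
qed

section \<open>The invariants of the mapping\<close>

theorem theorem3p1:
  fixes M :: "(real ^ 'n::finite) set"
    and \<psi> :: "'n covector_field" and a :: "'n space_data" and Lbar :: "'n connection"
  assumes "CARD('n) > 1"
    and "open M"
    and "equitorsion_pi3_mapping M \<psi> a Lbar"
  shows
    "total_invariance corresponding_data M a Lbar thomas
     \<and>
     (valued_invariance (assoc_inv :: 'n space_data \<Rightarrow> _)
      \<and> (total_invariance inverse_data M a Lbar assoc_inv \<longleftrightarrow> reciprocity M a Lbar))
     \<and>
     (valued_invariance (weyl_inv :: 'n space_data \<Rightarrow> _)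
      \<and> (total_invariance inverse_data M a Lbar weyl_inv \<longleftrightarrow> reciprocity M a Lbar)
      \<and> valued_invariance (weyl_inv_printed :: 'n space_data \<Rightarrow> _)
      \<and> (total_invariance inverse_data M a Lbar weyl_inv_printed \<longleftrightarrow>
           reciprocity M a Lbar \<and> (\<forall>x\<in>M. \<forall>m n. sigma_phi_curl a x m n = 0)))
     \<and>
     (\<forall>u u'. \<forall>p \<in> {1, 2} \<times> {1, 2} \<times> {1, 2}. \<forall>q \<in> {1, 2} \<times> {1, 2} \<times> {1, 2}.
        valued_invariance (with_torsion assoc_inv u u' p q :: 'n space_data \<Rightarrow> _)
      \<and> (total_invariance inverse_data M a Lbar (with_torsion assoc_inv u u' p q)
           \<longleftrightarrow> reciprocity M a Lbar)
      \<and> valued_invariance (with_torsion weyl_inv u u' p q :: 'n space_data \<Rightarrow> _)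
      \<and> (total_invariance inverse_data M a Lbar (with_torsion weyl_inv u u' p q)
           \<longleftrightarrow> reciprocity M a Lbar)
      \<and> valued_invariance (with_torsion weyl_inv_printed u u' p q :: 'n space_data \<Rightarrow> _)
      \<and> (total_invariance inverse_data M a Lbar (with_torsion weyl_inv_printed u u' p q) \<longleftrightarrow>
           reciprocity M a Lbar \<and> (\<forall>x\<in>M. \<forall>m n. sigma_phi_curl a x m n = 0)))"
proof -
  note rec = reciprocity_equitorsion[OF assms(2,3)]
  note assoc = thomas_determined_assoc_inv[where 'n = 'n]
    and weyl = thomas_determined_weyl_inv[OF assms(1)]
  have plain: "valued_invariance W \<and> (total_invariance inverse_data M a Lbar W \<longleftrightarrow> reciprocity M a Lbar)"
    if "thomas_determined W" for W :: "'n space_data \<Rightarrow> real ^ 'n \<Rightarrow> 'n \<Rightarrow> 'n \<Rightarrow> 'n \<Rightarrow> 'n \<Rightarrow> real"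
    using valued_invariance_add_curl[OF that, of W 0] total_invariance_add_curl[OF assms(2,3) that, of W 0] rec
    by simp
  have shifted: "valued_invariance U \<and> (total_invariance inverse_data M a Lbar U
      \<longleftrightarrow> reciprocity M a Lbar \<and> (\<forall>x\<in>M. \<forall>m n. sigma_phi_curl a x m n = 0))"
    if "thomas_determined W"
      and U: "\<And>a x i j m n. U a x i j m n
        = W a x i j m n + 1 / (real CARD('n) + 1) * delta i j * sigma_phi_curl a x m n"
    for U W :: "'n space_data \<Rightarrow> real ^ 'n \<Rightarrow> 'n \<Rightarrow> 'n \<Rightarrow> 'n \<Rightarrow> 'n \<Rightarrow> real"
  proof -
    have "1 / (real CARD('n) + 1) \<noteq> 0"
      by (simp add: add_nonneg_eq_0_iff)
    then show ?thesis
      using valued_invariance_add_curl[OF that(1) U] total_invariance_add_curl[OF assms(2,3) that(1) U] rec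
      by blast
  qed
  obtain b where "inverse_data M a Lbar b"
    using ex_inverse_data[OF assms(2,3)] .
  then have "total_invariance corresponding_data M a Lbar thomas"
    unfolding total_invariance_def inverse_data_def using corresponding_thomas[OF assms(3)] by blast
  moreover have "valued_invariance W \<and> (total_invariance inverse_data M a Lbar W
      \<longleftrightarrow> reciprocity M a Lbar \<and> (\<forall>x\<in>M. \<forall>m n. sigma_phi_curl a x m n = 0))"
    if "W = weyl_inv_printed" for W :: "'n space_data \<Rightarrow> _"
    unfolding that by (rule shifted[OF weyl]) (simp add: weyl_inv_def)
  moreover have "valued_invariance W \<and> (total_invariance inverse_data M a Lbar W
      \<longleftrightarrow> reciprocity M a Lbar \<and> (\<forall>x\<in>M. \<forall>m n. sigma_phi_curl a x m n = 0))"
    if "W = with_torsion weyl_inv_printed u u' p q" for W :: "'n space_data \<Rightarrow> _" and u u' p q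
    unfolding that
    by (rule shifted[OF thomas_determined_with_torsion[OF weyl]]) (simp add: with_torsion_def weyl_inv_def)
  ultimately show ?thesis
    using plain[OF assoc] plain[OF weyl] plain[OF thomas_determined_with_torsion[OF assoc]]
      plain[OF thomas_determined_with_torsion[OF weyl]]
    by (intro conjI allI ballI) (simp_all only:)
qed

end
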